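(* Let $D\subset\mathbb R^n$, $n\ge2$, be a domain, $q\ge1$, and let $f:D\to\mathbb R^n$ be differentiable a.e. in $D$, have the $N$- and $N^{-1}$-properties and property $L^{(2)}_q$. Then for every family $\Gamma$ of curves in $D$ and every $\rho\in\operatorname{adm}\Gamma$, $$M_q(f(\Gamma))\le\int_D K_{I,q}(x,f)\,\rho^q(x)\,dm(x).$$
   Context: $m$ is Lebesgue measure; mappings are continuous and orientation preserving. Curves are continuous maps of intervals; $f(\Gamma)=\{f\circ\gamma:\gamma\in\Gamma\}$. $\rho\in\operatorname{adm}\Gamma$ means $\rho:\mathbb R^n\to[0,\infty]$ Borel with $\int_\gamma\rho|dx|\ge1$ for all locally rectifiable $\gamma\in\Gamma$; $M_q(\Gamma)=\inf_{\rho\in\operatorname{adm}\Gamma}\int\rho^q\,dm$; "$q$-a.e." means outside a subfamily of $q$-modulus zero. $N$-property: $m(f(S))=0$ whenever $m(S)=0$; $N^{-1}$-property: $m(f^{-1}(S))=0$ whenever $m(S)=0$. For locally rectifiable $\gamma$ with $f\circ\gamma$ locally rectifiable, $L_{\gamma,f}$ is the nondecreasing function with $L_{\gamma,f}(l_\gamma(t))=l_{f\circ\gamma}(t)$, $l_\gamma$ the signed length function. Property $L^{(2)}_q$: for $q$-a.e. curve $\tilde\gamma$ in $f(D)$, every curve $\gamma$ in $D$ with $f\circ\gamma=\tilde\gamma$ is locally rectifiable and $L_{\gamma,f}$ has the $N^{-1}$-property. At differentiability points, $l(f'(x))=\min_{|h|=1}|f'(x)h|$, $J(x,f)=\det f'(x)$,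 and $K_{I,q}(x,f)=|J(x,f)|/l(f'(x))^q$ if $J(x,f)\ne0$, $=1$ if $f'(x)=0$, $=\infty$ otherwise. *)

theory Defs
  imports "HOL-Analysis.Analysis"
begin

text \<open>A curve is a continuous map of a (nondegenerate) real interval.  We represent it as
  a pair (I, g) of the parameter interval I and the map g; only the values of g on I matter.\<close>

type_synonym 'a curve = "real set \<times> (real \<Rightarrow> 'a)"

definition is_curve :: "'a::topological_space curve \<Rightarrow> bool" where
  "is_curve \<gamma> \<longleftrightarrow> is_interval (fst \<gamma>) \<and> (\<exists>a b. a < b \<and> a \<in> fst \<gamma> \<and> b \<in> fst \<gamma>)
      \<and> continuous_on (fst \<gamma>) (snd \<gamma>)"

definition curve_in :: "'a::topological_space curve \<Rightarrow> 'a set \<Rightarrow> bool" where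
  "curve_in \<gamma> A \<longleftrightarrow> is_curve \<gamma> \<and> snd \<gamma> ` fst \<gamma> \<subseteq> A"

definition seg_length :: "(real \<Rightarrow> 'a::metric_space) \<Rightarrow> real \<Rightarrow> real \<Rightarrow> ennreal" where
  "seg_length g a b = (SUP p \<in> {(k, t). (k::nat) \<ge> 0 \<and> t 0 = a \<and> t k = b
                                    \<and> (\<forall>i<k. t i \<le> t (Suc i))}.
        ennreal (\<Sum>i<fst p. dist (g (snd p (Suc i))) (g (snd p i))))"

definition loc_rectifiable :: "'a::metric_space curve \<Rightarrow> bool" where
  "loc_rectifiable \<gamma> \<longleftrightarrow> (\<forall>a\<in>fst \<gamma>. \<forall>b\<in>fst \<gamma>. a \<le> b \<longrightarrow> seg_length (snd \<gamma>) a b < \<infinity>)"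

definition base_pt :: "'a curve \<Rightarrow> real" where
  "base_pt \<gamma> = (SOME t. t \<in> fst \<gamma>)"

definition signed_length :: "'a::metric_space curve \<Rightarrow> real \<Rightarrow> real" where
  "signed_length \<gamma> t =
     (if base_pt \<gamma> \<le> t then enn2real (seg_length (snd \<gamma>) (base_pt \<gamma>) t)
      else - enn2real (seg_length (snd \<gamma>) t (base_pt \<gamma>)))"

definition line_integral :: "('a::metric_space \<Rightarrow> ennreal) \<Rightarrow> 'a curve \<Rightarrow> ennreal" where
  "line_integral \<rho> \<gamma> =
     (SUP ab \<in> {(a, b). a \<in> fst \<gamma> \<and> b \<in> fst \<gamma> \<and> a \<le> b}.
        (\<integral>\<^sup>+ t \<in> {fst ab..snd ab}. \<rho> (snd \<gamma> t)
           \<partial>interval_measure (\<lambda>s. enn2real (seg_length (snd \<gamma>) (fst ab) (max (fst ab) (min (snd ab) s))))))"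

definition curve_image :: "('a \<Rightarrow> 'b) \<Rightarrow> 'a curve set \<Rightarrow> 'b curve set" where
  "curve_image f \<Gamma> = (\<lambda>\<gamma>. (fst \<gamma>, f \<circ> snd \<gamma>)) ` \<Gamma>"

definition adm :: "'a::euclidean_space curve set \<Rightarrow> ('a \<Rightarrow> ennreal) set" where
  "adm \<Gamma> = {\<rho>. \<rho> \<in> borel_measurable borel \<and>
      (\<forall>\<gamma>\<in>\<Gamma>. loc_rectifiable \<gamma> \<longrightarrow> line_integral \<rho> \<gamma> \<ge> 1)}"

definition epow :: "ennreal \<Rightarrow> real \<Rightarrow> ennreal" where
  "epow x q = (if x = \<infinity> then \<infinity> else ennreal (enn2real x powr q))"

definition modulus :: "real \<Rightarrow> 'a::euclidean_space curve set \<Rightarrow> ennreal" where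
  "modulus q \<Gamma> = (INF \<rho> \<in> adm \<Gamma>. \<integral>\<^sup>+ x. epow (\<rho> x) q \<partial>lebesgue)"

definition N_property :: "('a::euclidean_space \<Rightarrow> 'a) \<Rightarrow> 'a set \<Rightarrow> bool" where
  "N_property f D \<longleftrightarrow> (\<forall>S. S \<subseteq> D \<longrightarrow> S \<in> null_sets lebesgue \<longrightarrow> f ` S \<in> null_sets lebesgue)"

definition N_inv_property :: "('a::euclidean_space \<Rightarrow> 'a) \<Rightarrow> 'a set \<Rightarrow> bool" where
  "N_inv_property f D \<longleftrightarrow>
     (\<forall>S. S \<in> null_sets lebesgue \<longrightarrow> (f -` S \<inter> D) \<in> null_sets lebesgue)"

text \<open>N^{-1}-property of L_{gamma,f}, the nondecreasing function with
  L(l_gamma(t)) = l_{f o gamma}(t) on l_gamma(I): the preimage L^{-1}(S) is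
  l_gamma({t in I. l_{f o gamma}(t) in S}).\<close>
definition L_N_inv :: "('a::metric_space \<Rightarrow> 'b::metric_space) \<Rightarrow> 'a curve \<Rightarrow> bool" where
  "L_N_inv f \<gamma> \<longleftrightarrow> (\<forall>S. S \<in> null_sets lebesgue \<longrightarrow>
      signed_length \<gamma> ` {t \<in> fst \<gamma>. signed_length (fst \<gamma>, f \<circ> snd \<gamma>) t \<in> S}
        \<in> null_sets lebesgue)"

definition L2_property :: "real \<Rightarrow> ('a::euclidean_space \<Rightarrow> 'a) \<Rightarrow> 'a set \<Rightarrow> bool" where
  "L2_property q f D \<longleftrightarrow> (\<exists>\<Gamma>0. modulus q \<Gamma>0 = 0 \<and>
     (\<forall>\<gamma>'. curve_in \<gamma>' (f ` D) \<and> \<gamma>' \<notin> \<Gamma>0 \<longrightarrow>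
        (\<forall>\<gamma>. curve_in \<gamma> D \<and> fst \<gamma> = fst \<gamma>' \<and> (\<forall>t\<in>fst \<gamma>. f (snd \<gamma> t) = snd \<gamma>' t) \<longrightarrow>
           loc_rectifiable \<gamma> \<and> (loc_rectifiable \<gamma>' \<longrightarrow> L_N_inv f \<gamma>))))"

definition min_stretch :: "(real^'n \<Rightarrow> real^'n) \<Rightarrow> real" where
  "min_stretch L = Inf {norm (L h) | h. norm h = 1}"

definition K_I :: "real \<Rightarrow> real^'n \<Rightarrow> (real^'n \<Rightarrow> real^'n) \<Rightarrow> ennreal" where
  "K_I q x f =
     (let f' = frechet_derivative f (at x); J = det (matrix f') in
      if \<not> f differentiable (at x) then \<infinity>
      else if J \<noteq> 0 then ennreal (\<bar>J\<bar> / (min_stretch f' powr q))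
      else if (\<forall>h. f' h = 0) then 1
      else \<infinity>)"

end

(* Away from a null set whose image is also null, D is a countable union of disjoint Borel pieces S_k on
   which f is injective, |f y - f x| >= c_k |y - x| for x in S_k and y near x, and
   c_k <= l(f'(x)) <= kappa c_k. Here the N^{-1}-property and Sard's theorem give J /= 0 almost everywhere.
   Let rho' be rho / c_k carried over to f(S_k), combined by a supremum over k, and infinity on a Borel null set
   containing the image of the exceptional set. The change of variables formula bounds the integral of rho'^q
   by kappa^q times the right-hand side. For a curve gamma with f o gamma rectifiable, the local expansion
   shows directly from partitions that length(gamma) <= length(f o gamma) / c_k as measures on gamma^{-1}(S_k),
   while the N^{-1}-property of L_{gamma,f} says that the length measure of gamma is absolutely continuous
   with respect to that of f o gamma. Hence the integral of rho along gamma is at most that of rho' along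
   f o gamma. Finally kappa tends to 1. *)
theory Submission
  imports Defs
begin

section \<open>Additivity and semicontinuity of length\<close>

text \<open>A curve may leave a piece and return to it between any two parameters. Expansion is
  therefore required at each x of a piece against all nearby y of \<open>D\<close>, inside the piece
  or not, and lengths are compared as Stieltjes measures instead of through a chain rule. The value
  infinity near the exceptional set settles an alternative: either f o \<gamma> spends positive
  length there and its integral is infinite, or it spends none and absolute continuity discards
  those parameters for \<gamma> as well. Images of different pieces may overlap. The q-th power of a
  supremum is at most the sum of the q-th powers, which can fail for the q-th power of a sum. The
  factor \<open>\<kappa>\<close> is the price of one constant c_k for a whole piece: the length
  comparison divides by c_k, while the integral is to contain l(f'(x)). The exceptional family of
  property L^(2) admits densities of arbitrarily small q-integral, so a maximum with such a density
  restores admissibility at an arbitrarily small cost.\<close>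

lemma dist_sum_le_seg_length:
  assumes "t 0 = a" "t k = b" "\<And>i. i < k \<Longrightarrow> t i \<le> t (Suc i)"
  shows "ennreal (\<Sum>i<k. dist (g (t (Suc i))) (g (t i))) \<le> seg_length g a b"
  unfolding seg_length_def using assms
  by (intro SUP_upper2[where i = "(k, t)"]) auto

lemma seg_length_leI:
  assumes "\<And>k t. t 0 = a \<Longrightarrow> t k = b \<Longrightarrow> (\<And>i. i < k \<Longrightarrow> t i \<le> t (Suc i))
     \<Longrightarrow> ennreal (\<Sum>i<k. dist (g (t (Suc i))) (g (t i))) \<le> B"
  shows "seg_length g a b \<le> B"
  unfolding seg_length_def using assms by (intro SUP_least) auto

lemma dist_le_seg_length:
  assumes "a \<le> b"
  shows "ennreal (dist (g b) (g a)) \<le> seg_length g a b"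
  using dist_sum_le_seg_length[of "\<lambda>i. if i = 0 then a else b" a 1 b g] assms by simp

lemma partition_mono:
  fixes t :: "nat \<Rightarrow> real"
  assumes "\<And>i. i < k \<Longrightarrow> t i \<le> t (Suc i)" "i \<le> j" "j \<le> k"
  shows "t i \<le> t j"
  using assms(2,3)
proof (induction j rule: dec_induct)
  case (step n)
  then show ?case using assms(1)[of n] by auto
qed simp

text \<open>The increments of \<open>H\<close> telescope over every partition. \<open>H\<close> need
  not be the length of anything, which permits majorants assembled from two different
  measures.\<close>

lemma seg_length_le_additive:
  assumes "a \<le> b"
    and "\<And>u v. a \<le> u \<Longrightarrow> u \<le> v \<Longrightarrow> v \<le> b \<Longrightarrow> dist (g v) (g u) \<le> H v - H u"
  shows "seg_length g a b \<le> ennreal (H b - H a)"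
proof (rule seg_length_leI)
  fix k and t :: "nat \<Rightarrow> real"
  assume t: "t 0 = a" "t k = b" "\<And>i. i < k \<Longrightarrow> t i \<le> t (Suc i)"
  have "(\<Sum>i<k. dist (g (t (Suc i))) (g (t i))) \<le> (\<Sum>i<k. H (t (Suc i)) - H (t i))"
  proof (rule sum_mono)
    fix i assume "i \<in> {..<k}"
    then have i: "i < k" by simp
    show "dist (g (t (Suc i))) (g (t i)) \<le> H (t (Suc i)) - H (t i)"
      using partition_mono[of k t 0 i] partition_mono[of k t "Suc i" k] t i
      by (intro assms(2)) auto
  qed
  also have "\<dots> = H b - H a"
    using sum_lessThan_telescope[of "\<lambda>i. H (t i)" k] t by simp
  finally show "ennreal (\<Sum>i<k. dist (g (t (Suc i))) (g (t i))) \<le> ennreal (H b - H a)"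
    by (rule ennreal_leI)
qed

lemma seg_length_concat_le:
  assumes "a \<le> b" "b \<le> c"
  shows "seg_length g a b + seg_length g b c \<le> seg_length g a c"
proof -
  let ?P = "\<lambda>a b. {(k, t). (k::nat) \<ge> 0 \<and> t 0 = a \<and> t k = b \<and> (\<forall>i<k. t i \<le> t (Suc i :: nat))}
     :: (nat \<times> (nat \<Rightarrow> real)) set"
  let ?s = "\<lambda>p. ennreal (\<Sum>i<fst p. dist (g (snd p (Suc i))) (g (snd p i)))"
  have ne: "?P a b \<noteq> {}" if "a \<le> b" for a b
    using that by (auto intro!: exI[of _ "1::nat"] exI[of _ "\<lambda>i. if i = 0 then a else b"])
  have "?s p + ?s q \<le> seg_length g a c" if p: "p \<in> ?P a b" and q: "q \<in> ?P b c" for p q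
  proof -
    obtain k t m u where [simp]: "p = (k, t)" "q = (m, u)" by (cases p, cases q)
    \<comment> \<open>The two branches agree at \<open>i = k\<close>, because both partitions take
      the value \<open>b\<close> there; so \<open>w\<close> is a partition through the common
      point.\<close>
    define w where "w i = (if i \<le> k then t i else u (i - k))" for i
    have t: "t 0 = a" "t k = b" "\<And>i. i < k \<Longrightarrow> t i \<le> t (Suc i)"
      and u: "u 0 = b" "u m = c" "\<And>i. i < m \<Longrightarrow> u i \<le> u (Suc i)"
      using p q by auto
    have w1: "w i = t i" if "i \<le> k" for i
      using that by (simp add: w_def)
    have w2: "w (k + i) = u i" for i
      using t u by (simp add: w_def)
    have "(\<Sum>i<k + m. dist (g (w (Suc i))) (g (w i)))
      = (\<Sum>i<k. dist (g (w (Suc i))) (g (w i))) + (\<Sum>i<m. dist (g (w (k + Suc i))) (g (w (k + i))))"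
      by (induction m) auto
    also have "\<dots> = (\<Sum>i<k. dist (g (t (Suc i))) (g (t i))) + (\<Sum>i<m. dist (g (u (Suc i))) (g (u i)))"
      unfolding w2 by (simp add: w1)
    finally have eq: "?s p + ?s q = ennreal (\<Sum>i<k + m. dist (g (w (Suc i))) (g (w i)))"
      by (simp add: ennreal_plus sum_nonneg)
    have mono: "w i \<le> w (Suc i)" if "i < k + m" for i
    proof (cases "i < k")
      case True
      then show ?thesis using t by (simp add: w1)
    next
      case False
      then obtain j where j: "i = k + j" by (metis le_add_diff_inverse not_less)
      then show ?thesis using that u(3)[of j] w2[of j] w2[of "Suc j"] by simp
    qed
    show ?thesis
      unfolding eq using w1[of 0] w2[of m] t u mono by (intro dist_sum_le_seg_length) auto
  qed
  note step = this
  have sl: "seg_length g a b = (SUP p\<in>?P a b. ?s p)" for a b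
    unfolding seg_length_def ..
  have "?s p + seg_length g b c \<le> seg_length g a c" if "p \<in> ?P a b" for p
    unfolding sl[of b c] ennreal_SUP_add_right[OF ne[OF assms(2)]] using step[OF that] by (rule SUP_least)
  then have "(SUP p\<in>?P a b. ?s p + seg_length g b c) \<le> seg_length g a c"
    by (rule SUP_least)
  then show ?thesis
    unfolding sl[of a b] ennreal_SUP_add_left[OF ne[OF assms(1)]] .
qed

lemma seg_length_le_concat:
  assumes "a \<le> b" "b \<le> c"
  shows "seg_length g a c \<le> seg_length g a b + seg_length g b c"
proof (rule seg_length_leI)
  fix k and t :: "nat \<Rightarrow> real"
  assume t: "t 0 = a" "t k = c" "\<And>i. i < k \<Longrightarrow> t i \<le> t (Suc i)"
  let ?s = "\<lambda>t. \<Sum>i<k. dist (g (t (Suc i))) (g (t i))"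
  \<comment> \<open>Clipping at \<open>b\<close> from above and from below yields partitions of the
    two halves. A step that straddles \<open>b\<close> is split by the triangle inequality; any
    other step survives in one half and degenerates in the other.\<close>
  have "?s t \<le> ?s (\<lambda>i. min (t i) b) + ?s (\<lambda>i. max (t i) b)"
    unfolding sum.distrib[symmetric]
  proof (rule sum_mono)
    fix i assume "i \<in> {..<k}"
    then have "t i \<le> t (Suc i)" using t by auto
    then show "dist (g (t (Suc i))) (g (t i))
      \<le> dist (g (min (t (Suc i)) b)) (g (min (t i) b)) + dist (g (max (t (Suc i)) b)) (g (max (t i) b))"
      using dist_triangle[of "g (t (Suc i))" "g (t i)" "g b"]
      by (auto simp: min_def max_def dist_commute)
  qed
  then have "ennreal (?s t) \<le> ennreal (?s (\<lambda>i. min (t i) b)) + ennreal (?s (\<lambda>i. max (t i) b))"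
    by (subst ennreal_plus[symmetric]) (auto intro!: ennreal_leI sum_nonneg)
  also have "\<dots> \<le> seg_length g a b + seg_length g b c"
    using t assms
    by (intro add_mono dist_sum_le_seg_length) (auto simp: min_le_iff_disj le_max_iff_disj dest: t(3))
  finally show "ennreal (?s t) \<le> seg_length g a b + seg_length g b c" .
qed

lemma seg_length_add:
  assumes "a \<le> b" "b \<le> c"
  shows "seg_length g a c = seg_length g a b + seg_length g b c"
  using seg_length_concat_le[OF assms, of g] seg_length_le_concat[OF assms, of g] by (rule antisym[rotated])

lemma seg_length_subinterval:
  assumes "a \<le> u" "u \<le> v" "v \<le> b"
  shows "seg_length g u v \<le> seg_length g a b"
  using seg_length_add[of a u b g] seg_length_add[of u v b g] assms
  by (simp add: add_increasing add_increasing2)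

text \<open>Length is lower semicontinuous in the endpoints, being a supremum of continuous functions of them.\<close>
lemma seg_length_le_of_right_approx:
  fixes g :: "real \<Rightarrow> 'a::metric_space"
  assumes g: "continuous_on {a..b} g" and "a < b"
    and B: "\<And>u. a < u \<Longrightarrow> u < b \<Longrightarrow> seg_length g u b \<le> B"
  shows "seg_length g a b \<le> B"
proof (rule seg_length_leI)
  fix k and t :: "nat \<Rightarrow> real"
  assume t: "t 0 = a" "t k = b" "\<And>i. i < k \<Longrightarrow> t i \<le> t (Suc i)"
  have rng: "a \<le> t i \<and> t i \<le> b" if "i \<le> k" for i
    using partition_mono[of k t 0 i] partition_mono[of k t i k] t that by auto
  \<comment> \<open>A fixed partition of [a,b], clipped from below at \<open>u\<close>, is a
    partition of [u,b]; its chord sum depends continuously on \<open>u\<close> and is the original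
    sum at \<open>u = a\<close>.\<close>
  let ?S = "\<lambda>u. \<Sum>i<k. dist (g (max (t (Suc i)) u)) (g (max (t i) u))"
  have cont: "continuous_on {a..b} (\<lambda>u. g (max (t i) u))" if "i \<le> k" for i
    using rng[OF that]
    by (intro continuous_on_compose2[OF g] continuous_on_max continuous_on_const continuous_on_id) auto
  have "continuous_on {a..b} ?S"
    by (intro continuous_intros cont) auto
  then have "(?S \<longlongrightarrow> ?S a) (at_right a)"
    using \<open>a < b\<close> at_within_Icc_at_right[OF \<open>a < b\<close>] by (auto simp: continuous_on_def dest!: bspec[where x = a])
  then have "((\<lambda>u. ennreal (?S u)) \<longlongrightarrow> ennreal (?S a)) (at_right a)"
    by (rule tendsto_ennrealI)
  moreover have "\<forall>\<^sub>F u in at_right a. ennreal (?S u) \<le> B"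
    using eventually_at_right_real[OF \<open>a < b\<close>]
  proof eventually_elim
    case (elim u)
    then have "ennreal (?S u) \<le> seg_length g u b"
      using t rng by (intro dist_sum_le_seg_length) (auto simp: min_le_iff_disj le_max_iff_disj dest: t(3))
    also have "\<dots> \<le> B" using B elim by simp
    finally show ?case .
  qed
  ultimately have "ennreal (?S a) \<le> B"
    by (intro tendsto_upperbound) auto
  moreover have "?S a = (\<Sum>i<k. dist (g (t (Suc i))) (g (t i)))"
    using rng by (intro sum.cong) (auto simp: max_absorb1)
  ultimately show "ennreal (\<Sum>i<k. dist (g (t (Suc i))) (g (t i))) \<le> B" by simp
qed

lemma seg_length_le_of_left_approx:
  fixes g :: "real \<Rightarrow> 'a::metric_space"
  assumes g: "continuous_on {a..b} g" and "a < b"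
    and B: "\<And>u. a < u \<Longrightarrow> u < b \<Longrightarrow> seg_length g a u \<le> B"
  shows "seg_length g a b \<le> B"
proof (rule seg_length_leI)
  fix k and t :: "nat \<Rightarrow> real"
  assume t: "t 0 = a" "t k = b" "\<And>i. i < k \<Longrightarrow> t i \<le> t (Suc i)"
  have rng: "a \<le> t i \<and> t i \<le> b" if "i \<le> k" for i
    using partition_mono[of k t 0 i] partition_mono[of k t i k] t that by auto
  let ?S = "\<lambda>u. \<Sum>i<k. dist (g (min (t (Suc i)) u)) (g (min (t i) u))"
  have cont: "continuous_on {a..b} (\<lambda>u. g (min (t i) u))" if "i \<le> k" for i
    using rng[OF that]
    by (intro continuous_on_compose2[OF g] continuous_on_min continuous_on_const continuous_on_id) auto
  have "continuous_on {a..b} ?S"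
    by (intro continuous_intros cont) auto
  then have "(?S \<longlongrightarrow> ?S b) (at_left b)"
    using \<open>a < b\<close> at_within_Icc_at_left[OF \<open>a < b\<close>] by (auto simp: continuous_on_def dest!: bspec[where x = b])
  then have "((\<lambda>u. ennreal (?S u)) \<longlongrightarrow> ennreal (?S b)) (at_left b)"
    by (rule tendsto_ennrealI)
  moreover have "\<forall>\<^sub>F u in at_left b. ennreal (?S u) \<le> B"
    using eventually_at_left_real[OF \<open>a < b\<close>]
  proof eventually_elim
    case (elim u)
    then have "ennreal (?S u) \<le> seg_length g a u"
      using t rng by (intro dist_sum_le_seg_length) (auto simp: min_le_iff_disj le_max_iff_disj dest: t(3))
    also have "\<dots> \<le> B" using B elim by simp
    finally show ?case .
  qed
  ultimately have "ennreal (?S b) \<le> B"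
    by (intro tendsto_upperbound) auto
  moreover have "?S b = (\<Sum>i<k. dist (g (t (Suc i))) (g (t i)))"
    using rng by (intro sum.cong) (auto simp: min_absorb1)
  ultimately show "ennreal (\<Sum>i<k. dist (g (t (Suc i))) (g (t i))) \<le> B" by simp
qed

section \<open>Stieltjes measures and half-open intervals\<close>

text \<open>The grid has mesh below the distance from K to the complement of U; P indexes the cells meeting K.\<close>
lemma compact_cover_half_open_intervals:
  fixes K U :: "real set"
  assumes "compact K" "open U" "K \<subseteq> U"
  obtains P :: "int set" and d :: real
  where "finite P" "d > 0" "K \<subseteq> (\<Union>i\<in>P. {of_int i * d<..(of_int i + 1) * d})"
    "(\<Union>i\<in>P. {of_int i * d..(of_int i + 1) * d}) \<subseteq> U"
    "disjoint_family_on (\<lambda>i. {of_int i * d<..(of_int i + 1) * d}) P"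
proof -
  have "closed (- U)" "- U \<inter> K = {}" using assms by auto
  from separate_closed_compact[OF this(1) assms(1) this(2)]
  obtain e where e: "e > 0" "\<And>x y. x \<notin> U \<Longrightarrow> y \<in> K \<Longrightarrow> e \<le> dist x y" by auto
  define d where "d = e / 2"
  have d: "d > 0" using e by (simp add: d_def)
  let ?I = "\<lambda>i::int. {of_int i * d<..(of_int i + 1) * d}"
  define P where "P = {i. ?I i \<inter> K \<noteq> {}}"
  obtain M where M: "\<And>x. x \<in> K \<Longrightarrow> \<bar>x\<bar> \<le> M"
    using compact_imp_bounded[OF assms(1)] by (auto simp: bounded_real)
  have bd: "\<bar>of_int i\<bar> \<le> M / d + 1" if i: "i \<in> P" for i
  proof -
    obtain x where "x \<in> K" and x: "of_int i * d < x" "x \<le> (of_int i + 1) * d"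
      using i unfolding P_def by auto
    note M[OF \<open>x \<in> K\<close>]
    with x have x: "of_int i * d < x" "x \<le> (of_int i + 1) * d" "\<bar>x\<bar> \<le> M" by auto
    then have "of_int i < M / d" "- M / d \<le> of_int i + 1"
      using d by (auto simp: field_simps)
    then show ?thesis by (auto simp: abs_if)
  qed
  have "P \<subseteq> {- \<lceil>M / d + 1\<rceil>..\<lceil>M / d + 1\<rceil>}"
  proof
    fix i assume "i \<in> P"
    from bd[OF this] show "i \<in> {- \<lceil>M / d + 1\<rceil>..\<lceil>M / d + 1\<rceil>}"
      by (auto simp: abs_le_iff) linarith+
  qed
  then have fin: "finite P" by (rule finite_subset) simp
  \<comment> \<open>The cells are open on the left, so a grid point \<open>i * d\<close> belongs to
    cell \<open>i - 1\<close>; hence the ceiling minus one.\<close>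
  have cover: "x \<in> ?I (\<lceil>x / d\<rceil> - 1)" for x
  proof -
    have "x / d \<le> of_int \<lceil>x / d\<rceil>" "of_int \<lceil>x / d\<rceil> - 1 < x / d" by linarith+
    from this(1)[unfolded pos_divide_le_eq[OF d]] this(2)[unfolded pos_less_divide_eq[OF d]]
    show ?thesis by simp
  qed
  have disj: "?I i \<inter> ?I j = {}" if "i \<noteq> j" for i j
  proof (rule ccontr)
    assume "?I i \<inter> ?I j \<noteq> {}"
    then obtain x where "x \<in> ?I i" "x \<in> ?I j"
      by blast
    then have "of_int i * d < (of_int j + 1) * d" "of_int j * d < (of_int i + 1) * d" by auto
    then have "real_of_int i < of_int j + 1" "real_of_int j < of_int i + 1"
      using d by simp_all
    then show False using that by linarith
  qed
  show thesis
  proof (rule that[of P d])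
    show "K \<subseteq> (\<Union>i\<in>P. ?I i)"
      using cover unfolding P_def by (fastforce simp del: greaterThanAtMost_iff)
    show "(\<Union>i\<in>P. {of_int i * d..(of_int i + 1) * d}) \<subseteq> U"
    proof clarify
      fix i x assume i: "i \<in> P" and x: "x \<in> {of_int i * d..(of_int i + 1) * d}"
      then obtain y where "y \<in> K" "of_int i * d < y" "y \<le> (of_int i + 1) * d"
        unfolding P_def by auto
      then have "dist x y \<le> d" using x by (auto simp: dist_real_def abs_le_iff algebra_simps)
      then have "dist x y < e" using e by (simp add: d_def)
      then show "x \<in> U" using e(2)[OF _ \<open>y \<in> K\<close>] by force
    qed
  qed (use fin d disj in \<open>auto simp: disjoint_family_on_def\<close>)
qed

text \<open>Finite Borel measures on the line are regular. Inner regularity of \<open>M\<close> and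
  outer regularity of \<open>N\<close> leave a compact set inside an open one, and a finite disjoint
  union of half-open cells fits between them.\<close>

lemma measure_le_if_le_half_open:
  fixes M N :: "real measure"
  assumes [measurable_cong, simp]: "sets M = sets borel" "sets N = sets borel"
    and fin: "emeasure M UNIV \<noteq> \<infinity>" "emeasure N UNIV \<noteq> \<infinity>"
    and le: "\<And>u v. u \<le> v \<Longrightarrow> emeasure M {u<..v} \<le> emeasure N {u<..v}"
    and A: "A \<in> sets borel"
  shows "emeasure M A \<le> emeasure N A"
proof -
  have sp: "space M = UNIV" "space N = UNIV"
    using sets_eq_imp_space_eq[of M borel] sets_eq_imp_space_eq[of N borel] by auto
  have K: "emeasure M K \<le> emeasure N K" if "compact K" for K
  proof -
    have "emeasure M K \<le> emeasure N U" if U: "open U" "K \<subseteq> U" for U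
    proof -
      obtain P d where P: "finite P" "d > 0" "K \<subseteq> (\<Union>i\<in>P. {of_int i * d<..(of_int i + 1) * d})"
        "(\<Union>i\<in>P. {of_int i * d..(of_int i + 1) * d}) \<subseteq> U"
        "disjoint_family_on (\<lambda>i. {of_int i * d<..(of_int i + 1) * d}) P"
        by (rule compact_cover_half_open_intervals[OF \<open>compact K\<close> U])
      let ?I = "\<lambda>i::int. {of_int i * d<..(of_int i + 1) * d}"
      have "emeasure M K \<le> emeasure M (\<Union>i\<in>P. ?I i)"
        using P by (intro emeasure_mono) auto
      also have "\<dots> = (\<Sum>i\<in>P. emeasure M (?I i))"
        using P by (intro sum_emeasure[symmetric]) auto
      also have "\<dots> \<le> (\<Sum>i\<in>P. emeasure N (?I i))"
        using P by (intro sum_mono le) (auto simp: algebra_simps)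
      also have "\<dots> = emeasure N (\<Union>i\<in>P. ?I i)"
        using P by (intro sum_emeasure) auto
      also have "\<dots> \<le> emeasure N U"
        using P(4) U by (intro emeasure_mono) force+
      finally show ?thesis .
    qed
    moreover have "emeasure N K = (INF U \<in> {U. K \<subseteq> U \<and> open U}. emeasure N U)"
      using that fin sp by (intro outer_regular) (auto simp: compact_imp_closed)
    ultimately show ?thesis by (auto intro: INF_greatest)
  qed
  have "emeasure M A = (SUP K \<in> {K. K \<subseteq> A \<and> compact K}. emeasure M K)"
    using A fin sp by (intro inner_regular) auto
  also have "\<dots> \<le> emeasure N A"
  proof (rule SUP_least)
    fix K assume "K \<in> {K. K \<subseteq> A \<and> compact K}"
    then show "emeasure M K \<le> emeasure N A"
      using K[of K] emeasure_mono[of K A N] A by auto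
  qed
  finally show ?thesis .
qed

text \<open>The mass of a half-open cell is the length of an interval that contains its image under
  \<open>F\<close>. A cover of \<open>K\<close> by cells of small total mass therefore becomes a
  cover of the image by intervals of small total length.\<close>

lemma null_image_of_null_interval_measure:
  fixes F :: "real \<Rightarrow> real"
  assumes mono: "\<And>x y. x \<le> y \<Longrightarrow> F x \<le> F y" and cont: "continuous_on UNIV F"
    and fin: "emeasure (interval_measure F) UNIV \<noteq> \<infinity>"
    and K: "compact K" "emeasure (interval_measure F) K = 0"
  shows "F ` K \<in> null_sets lebesgue"
proof -
  let ?M = "interval_measure F"
  have rc: "continuous (at_right a) F" for a
    using cont by (simp add: continuous_on_eq_continuous_at continuous_at_imp_continuous_at_within)
  have "emeasure lborel (F ` K) \<le> 0 + ennreal e" if "e > 0" for e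
  proof -
    have "emeasure ?M K = (INF U \<in> {U. K \<subseteq> U \<and> open U}. emeasure ?M U)"
      using fin K by (intro outer_regular) (auto simp: compact_imp_closed)
    then have "(INF U \<in> {U. K \<subseteq> U \<and> open U}. emeasure ?M U) < ennreal e"
      using K that by simp
    then obtain U where U: "open U" "K \<subseteq> U" "emeasure ?M U < ennreal e"
      by (auto simp: INF_less_iff)
    obtain P d where P: "finite P" "d > 0" "K \<subseteq> (\<Union>i\<in>P. {of_int i * d<..(of_int i + 1) * d})"
        "(\<Union>i\<in>P. {of_int i * d..(of_int i + 1) * d}) \<subseteq> U"
        "disjoint_family_on (\<lambda>i. {of_int i * d<..(of_int i + 1) * d}) P"
      by (rule compact_cover_half_open_intervals[OF K(1) U(1,2)])
    let ?I = "\<lambda>i::int. {of_int i * d<..(of_int i + 1) * d}"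
    \<comment> \<open>Closed image intervals may share endpoints, which is harmless because only
      subadditivity follows.\<close>
    have "emeasure lborel (F ` K) \<le> emeasure lborel (\<Union>i\<in>P. {F (of_int i * d)..F ((of_int i + 1) * d)})"
      using P by (intro emeasure_mono) (force intro!: mono)+
    also have "\<dots> \<le> (\<Sum>i\<in>P. emeasure lborel {F (of_int i * d)..F ((of_int i + 1) * d)})"
      using P by (intro emeasure_subadditive_finite) auto
    also have "\<dots> = (\<Sum>i\<in>P. emeasure ?M (?I i))"
    proof (intro sum.cong refl)
      fix i
      have "of_int i * d \<le> (of_int i + 1) * d" using P(2) by (simp add: algebra_simps)
      then show "emeasure lborel {F (of_int i * d)..F ((of_int i + 1) * d)} = emeasure ?M (?I i)"
        by (simp add: emeasure_interval_measure_Ioc mono rc)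
    qed
    also have "\<dots> = emeasure ?M (\<Union>i\<in>P. ?I i)"
      using P by (intro sum_emeasure) auto
    also have "\<dots> \<le> emeasure ?M U"
      using P(4) U by (intro emeasure_mono) force+
    finally show ?thesis using U by simp
  qed
  then have "emeasure lborel (F ` K) \<le> 0"
    using ennreal_le_epsilon[of 0 "emeasure lborel (F ` K)"] by blast
  moreover have "compact (F ` K)"
    using K cont by (intro compact_continuous_image) (auto intro: continuous_on_subset)
  ultimately show ?thesis
    by (intro null_sets_completionI null_setsI) (auto simp: compact_imp_closed)
qed

text \<open>Here the small open set surrounds the image and is pulled back by the continuous
  \<open>F\<close>. Monotonicity makes the image intervals of distinct cells disjoint, and the
  intermediate value theorem keeps them inside the open set, so their lengths add up to at most its
  measure.\<close>

lemma null_interval_measure_of_null_image: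
  fixes F :: "real \<Rightarrow> real"
  assumes mono: "\<And>x y. x \<le> y \<Longrightarrow> F x \<le> F y" and cont: "continuous_on UNIV F"
    and K: "compact K" "F ` K \<in> null_sets lebesgue"
  shows "emeasure (interval_measure F) K = 0"
proof -
  let ?M = "interval_measure F"
  have rc: "continuous (at_right a) F" for a
    using cont by (simp add: continuous_on_eq_continuous_at continuous_at_imp_continuous_at_within)
  have "emeasure ?M K \<le> 0 + ennreal e" if "e > 0" for e
  proof -
    obtain U where U: "open U" "F ` K \<subseteq> U" "emeasure lebesgue (U - F ` K) < ennreal e"
      using sets_lebesgue_outer_open[of "F ` K" e] K \<open>e > 0\<close> by (metis null_setsD2)
    have lU: "emeasure lborel U < ennreal e"
      using U(3) emeasure_Diff_null_set[OF K(2), of U] U(1) by simp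
    have V: "open (F -` U)" "K \<subseteq> F -` U"
      using U cont by (auto simp: open_vimage)
    obtain P d where P: "finite P" "d > 0" "K \<subseteq> (\<Union>i\<in>P. {of_int i * d<..(of_int i + 1) * d})"
        "(\<Union>i\<in>P. {of_int i * d..(of_int i + 1) * d}) \<subseteq> F -` U"
        "disjoint_family_on (\<lambda>i. {of_int i * d<..(of_int i + 1) * d}) P"
      by (rule compact_cover_half_open_intervals[OF K(1) V])
    let ?I = "\<lambda>i::int. {of_int i * d<..(of_int i + 1) * d}"
    let ?J = "\<lambda>i::int. {F (of_int i * d)<..F ((of_int i + 1) * d)}"
    have disj: "?J i \<inter> ?J j = {}" if "i < j" for i j
    proof -
      have "(of_int i + 1) * d \<le> of_int j * d" using that P(2) by (intro mult_right_mono) auto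
      from mono[OF this] show ?thesis by auto
    qed
    have sub: "?J i \<subseteq> U" if "i \<in> P" for i
    proof
      fix y assume y: "y \<in> ?J i"
      have "of_int i * d \<le> (of_int i + 1) * d" using P(2) by (simp add: algebra_simps)
      then obtain x where "of_int i * d \<le> x" "x \<le> (of_int i + 1) * d" "F x = y"
        using IVT'[of F "of_int i * d" y "(of_int i + 1) * d"] y continuous_on_subset[OF cont] by auto
      then show "y \<in> U" using subsetD[OF P(4), of x] that by fastforce
    qed
    have "emeasure ?M K \<le> emeasure ?M (\<Union>i\<in>P. ?I i)"
      using P by (intro emeasure_mono) auto
    also have "\<dots> \<le> (\<Sum>i\<in>P. emeasure ?M (?I i))"
      using P by (intro emeasure_subadditive_finite) auto
    also have "\<dots> = (\<Sum>i\<in>P. emeasure lborel (?J i))"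
    proof (intro sum.cong refl)
      fix i
      have "of_int i * d \<le> (of_int i + 1) * d" using P(2) by (simp add: algebra_simps)
      then show "emeasure ?M (?I i) = emeasure lborel (?J i)"
        by (simp add: emeasure_interval_measure_Ioc mono rc)
    qed
    also have "\<dots> = emeasure lborel (\<Union>i\<in>P. ?J i)"
    proof (intro sum_emeasure)
      show "disjoint_family_on ?J P"
        unfolding disjoint_family_on_def using disj by (metis Int_commute neq_iff)
    qed (use P(1) in auto)
    also have "\<dots> \<le> emeasure lborel U"
      using sub U(1) by (intro emeasure_mono) auto
    finally show ?thesis using lU by simp
  qed
  then have "emeasure ?M K \<le> 0"
    using ennreal_le_epsilon[of 0 "emeasure ?M K"] by blast
  then show ?thesis by simp
qed

text \<open>Clipping the argument extends the arc length of [a,b] to the whole line by constants, so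
  that its Stieltjes measure lives on [a,b]. This is the integrator inside
  \<open>line_integral\<close>.\<close>

definition seg_fun :: "(real \<Rightarrow> 'a::metric_space) \<Rightarrow> real \<Rightarrow> real \<Rightarrow> real \<Rightarrow> real" where
  "seg_fun g a b s = enn2real (seg_length g a (max a (min b s)))"

locale rectifiable_path =
  fixes g :: "real \<Rightarrow> 'a::metric_space" and a b :: real
  assumes ab: "a \<le> b" and cont: "continuous_on {a..b} g" and fin: "seg_length g a b < \<infinity>"
begin

abbreviation "F \<equiv> seg_fun g a b"
abbreviation "M \<equiv> interval_measure F"

lemma seg_length_finite:
  assumes "a \<le> u" "u \<le> v" "v \<le> b"
  shows "seg_length g u v < \<infinity>"
  using seg_length_subinterval[OF assms, of g] fin by (rule le_less_trans)

lemma seg_fun_diff: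
  assumes "a \<le> u" "u \<le> v" "v \<le> b"
  shows "seg_length g u v = ennreal (F v - F u)"
proof -
  have "seg_length g a v = seg_length g a u + seg_length g u v"
    using assms by (intro seg_length_add) auto
  moreover have "seg_length g a v < \<infinity>" "seg_length g a u < \<infinity>" "seg_length g u v < \<infinity>"
    using assms seg_length_finite[of a v] seg_length_finite[of a u] seg_length_finite[of u v] by auto
  ultimately show ?thesis
    using assms by (auto simp: seg_fun_def max_absorb2 min_absorb2 enn2real_plus less_top)
qed

lemma seg_fun_mono: "x \<le> y \<Longrightarrow> F x \<le> F y"
proof -
  assume "x \<le> y"
  then have "max a (min b x) \<le> max a (min b y)" by auto
  moreover have "max a (min b y) \<le> b" using ab by auto
  ultimately show ?thesis
    unfolding seg_fun_def
    by (intro enn2real_mono seg_length_subinterval) (use ab seg_length_finite[of a "max a (min b y)"] in auto)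
qed

lemma dist_le_seg_fun:
  assumes "a \<le> u" "u \<le> v" "v \<le> b"
  shows "dist (g v) (g u) \<le> F v - F u"
  using dist_le_seg_length[OF assms(2), of g] seg_fun_diff[OF assms] seg_fun_mono[OF assms(2)]
  by (simp add: ennreal_le_iff)

lemma seg_fun_clip: "F (max a (min b s)) = F s"
  using ab by (simp add: seg_fun_def)

lemma seg_fun_bounds: "0 \<le> F s" "F s \<le> F b"
  using seg_fun_mono[of "max a (min b s)" b] ab by (auto simp: seg_fun_clip) (simp add: seg_fun_def)

text \<open>A jump of size \<open>e\<close> on one side of \<open>x\<close> would be missing from
  the length of every segment that stays on that side and avoids \<open>x\<close>. By semicontinuity
  it would be missing from the full segment too, which contradicts additivity.\<close>

lemma continuous_seg_fun: "continuous_on UNIV F"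
proof -
  have "continuous_on {a..b} F"
    unfolding continuous_on_iff
  proof (intro ballI allI impI)
    fix x e :: real assume x: "x \<in> {a..b}" and e: "e > 0"
    have "\<exists>d>0. \<forall>y\<in>{a..b}. x \<le> y \<and> y < x + d \<longrightarrow> F y < F x + e"
    proof (cases "x = b")
      case True
      then show ?thesis using e by (intro exI[of _ 1]) auto
    next
      case False
      then have xb: "a \<le> x" "x < b" using x by auto
      have "\<exists>u. x < u \<and> u < b \<and> F u < F x + e"
      proof (rule ccontr)
        assume *: "\<not> ?thesis"
        have "seg_length g x b \<le> ennreal (F b - F x - e)"
        proof (rule seg_length_le_of_right_approx)
          fix u assume u: "x < u" "u < b"
          then have "F x + e \<le> F u" using * by auto
          then show "seg_length g u b \<le> ennreal (F b - F x - e)"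
            using u xb by (subst seg_fun_diff) (auto intro!: ennreal_leI)
        qed (use xb continuous_on_subset[OF cont] in auto)
        \<comment> \<open>\<open>ennreal\<close> sends negative reals to 0, which produces the
          second alternative. It is refuted by a point \<open>u\<close> to the right of
          \<open>x\<close>, since \<open>F x + e \<le> F u \<le> F b\<close>.\<close>
        then have "F b - F x \<le> F b - F x - e \<or> F b - F x \<le> 0"
          using xb seg_fun_diff[of x b] by (auto simp: ennreal_le_iff2)
        moreover obtain u where "x < u" "u < b" using dense xb by blast
        moreover from this have "F x + e \<le> F u" using * by auto
        ultimately show False using e seg_fun_mono[of u b] by auto
      qed
      then obtain u where u: "x < u" "u < b" "F u < F x + e" by auto
      have "F y < F x + e" if "y < u" for y
        using seg_fun_mono[of y u] u that by simp
      then show ?thesis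
        using u by (intro exI[of _ "u - x"]) auto
    qed
    then obtain d1 where d1: "d1 > 0" "\<And>y. y \<in> {a..b} \<Longrightarrow> x \<le> y \<Longrightarrow> y < x + d1 \<Longrightarrow> F y < F x + e" by auto
    have "\<exists>d>0. \<forall>y\<in>{a..b}. y \<le> x \<and> x - d < y \<longrightarrow> F x - e < F y"
    proof (cases "x = a")
      case True
      then show ?thesis using e by (intro exI[of _ 1]) auto
    next
      case False
      then have xb: "a < x" "x \<le> b" using x by auto
      have "\<exists>u. a < u \<and> u < x \<and> F x - e < F u"
      proof (rule ccontr)
        assume *: "\<not> ?thesis"
        have "seg_length g a x \<le> ennreal (F x - F a - e)"
        proof (rule seg_length_le_of_left_approx)
          fix u assume u: "a < u" "u < x"
          then have "F u \<le> F x - e" using * by auto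
          then show "seg_length g a u \<le> ennreal (F x - F a - e)"
            using u xb by (subst seg_fun_diff) (auto intro!: ennreal_leI)
        qed (use xb continuous_on_subset[OF cont] in auto)
        then have "F x - F a \<le> F x - F a - e \<or> F x - F a \<le> 0"
          using xb seg_fun_diff[of a x] by (auto simp: ennreal_le_iff2)
        moreover obtain u where "a < u" "u < x" using dense xb by blast
        moreover from this have "F u \<le> F x - e" using * by auto
        ultimately show False using e seg_fun_mono[of a u] by auto
      qed
      then obtain u where u: "a < u" "u < x" "F x - e < F u" by auto
      have "F x - e < F y" if "u < y" for y
        using seg_fun_mono[of u y] u that by simp
      then show ?thesis
        using u by (intro exI[of _ "x - u"]) auto
    qed
    then obtain d2 where d2: "d2 > 0" "\<And>y. y \<in> {a..b} \<Longrightarrow> y \<le> x \<Longrightarrow> x - d2 < y \<Longrightarrow> F x - e < F y" by auto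
    show "\<exists>d>0. \<forall>y\<in>{a..b}. dist y x < d \<longrightarrow> dist (F y) (F x) < e"
    proof (intro exI[of _ "min d1 d2"] conjI ballI impI)
      fix y assume y: "y \<in> {a..b}" "dist y x < min d1 d2"
      show "dist (F y) (F x) < e"
      proof (cases "x \<le> y")
        case True
        then show ?thesis using d1(2)[OF y(1)] seg_fun_mono[of x y] y by (auto simp: dist_real_def)
      next
        case False
        then show ?thesis using d2(2)[OF y(1)] seg_fun_mono[of y x] y by (auto simp: dist_real_def)
      qed
    qed (use d1 d2 in auto)
  qed
  then have "continuous_on UNIV (\<lambda>s. F (max a (min b s)))"
    by (rule continuous_on_compose2)
      (use ab in \<open>auto intro!: continuous_on_max continuous_on_min continuous_on_const continuous_on_id\<close>)
  then show ?thesis by (simp add: seg_fun_clip)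
qed

lemma right_continuous_seg_fun: "continuous (at_right x) F"
  using continuous_seg_fun
  by (simp add: continuous_on_eq_continuous_at continuous_at_imp_continuous_at_within)

lemma emeasure_length_Ioc: "u \<le> v \<Longrightarrow> emeasure M {u<..v} = ennreal (F v - F u)"
  by (intro emeasure_interval_measure_Ioc seg_fun_mono right_continuous_seg_fun)

lemma emeasure_length_finite: "emeasure M UNIV \<noteq> \<infinity>"
proof -
  have "(UNIV :: real set) = (\<Union>n::nat. {- real n<..real n})"
  proof safe
    fix x :: real
    obtain n :: nat where "\<bar>x\<bar> < real n" using reals_Archimedean2 by blast
    then show "x \<in> (\<Union>n::nat. {- real n<..real n})" by (auto intro!: exI[of _ n])
  qed auto
  also have "emeasure M \<dots> = (SUP n. emeasure M {- real n<..real n})"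
    by (intro SUP_emeasure_incseq[symmetric]) (auto simp: incseq_def)
  also have "\<dots> \<le> ennreal (F b)"
  proof (intro SUP_least)
    fix n :: nat
    show "emeasure M {- real n<..real n} \<le> ennreal (F b)"
      using seg_fun_bounds(1)[of "- real n"] seg_fun_bounds(2)[of "real n"]
      by (simp add: emeasure_length_Ioc ennreal_leI)
  qed
  finally show ?thesis using ennreal_less_top[of "F b"] by (auto simp: top_unique)
qed

lemma finite_measure_length: "finite_measure M"
  using emeasure_length_finite by (intro finite_measureI) simp

lemma measure_length_Ioc: "u \<le> v \<Longrightarrow> measure M {u<..v} = F v - F u"
  by (simp add: measure_def emeasure_length_Ioc seg_fun_mono)

end

section \<open>Comparison of length measures\<close>

text \<open>Pieces of a partition that miss T contribute at most the length outside T; a piece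
  that meets T is compared with h through a point of T. No derivative along the path is needed.\<close>
lemma measure_length_le_of_locally_expanding:
  fixes g :: "real \<Rightarrow> 'a::metric_space" and h :: "real \<Rightarrow> 'b::metric_space"
  assumes g: "rectifiable_path g a b" and h: "rectifiable_path h a b"
    and T: "T \<in> sets borel" "T \<subseteq> {a..b}" and "c > 0" "r > 0"
    and exp: "\<And>s t. s \<in> T \<Longrightarrow> t \<in> {a..b} \<Longrightarrow> dist (g t) (g s) < r
      \<Longrightarrow> c * dist (g t) (g s) \<le> dist (h t) (h s)"
    and "u \<le> v"
  shows "measure (interval_measure (seg_fun g a b)) ({u<..v} \<inter> T)
    \<le> (seg_fun h a b v - seg_fun h a b u) / c"
  using \<open>u \<le> v\<close>
\<comment> \<open>The bound passes from adjacent intervals to their union, so a bisection argument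
  reduces it to intervals around a point \<open>x\<close> that are short enough for the radius
  \<open>r\<close> to apply.\<close>
proof (induction u v rule: Bolzano)
  interpret g: rectifiable_path g a b by (rule g)
  interpret h: rectifiable_path h a b by (rule h)
  interpret Mg: finite_measure g.M by (rule g.finite_measure_length)
  case (trans u w v)
  then have "{u<..v} \<inter> T = ({u<..w} \<inter> T) \<union> ({w<..v} \<inter> T)" by auto
  then have "measure g.M ({u<..v} \<inter> T) \<le> measure g.M ({u<..w} \<inter> T) + measure g.M ({w<..v} \<inter> T)"
    using T by (simp add: measure_Un_le)
  with trans show ?case by (simp add: diff_divide_distrib)
next
  interpret g: rectifiable_path g a b by (rule g)
  interpret h: rectifiable_path h a b by (rule h)
  interpret Mg: finite_measure g.M by (rule g.finite_measure_length)
  case (local x)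
  have triv: "measure g.M ({u<..v} \<inter> T) \<le> (h.F v - h.F u) / c" if "{u<..v} \<inter> T = {}" "u \<le> v" for u v
    using that h.seg_fun_mono[of u v] \<open>c > 0\<close> by simp
  consider "x < a" | "b < x" | "x \<in> {a..b}" by force
  then show ?case
  proof cases
    case 1
    have "{u<..v} \<inter> T = {}" if "v - u < a - x" "u \<le> x" for u v using T that by force
    then show ?thesis using 1 by (intro exI[of _ "a - x"] conjI allI impI triv) auto
  next
    case 2
    have "{u<..v} \<inter> T = {}" if "v - u < x - b" "x \<le> v" for u v using T that by force
    then show ?thesis using 2 by (intro exI[of _ "x - b"] conjI allI impI triv) auto
  next
    case 3
    \<comment> \<open>With \<open>r / 2\<close> around \<open>g x\<close>, any two points of the
      short piece of path are within \<open>r\<close> of each other.\<close>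
    obtain d where d: "d > 0" "\<And>y. y \<in> {a..b} \<Longrightarrow> dist y x < d \<Longrightarrow> dist (g y) (g x) < r / 2"
      using g.cont 3 \<open>r > 0\<close> unfolding continuous_on_iff by (metis half_gt_zero)
    have "measure g.M ({u<..v} \<inter> T) \<le> (h.F v - h.F u) / c" if uv: "u \<le> x" "x \<le> v" "v - u < d" for u v
    proof -
      \<comment> \<open>The hypotheses speak only about [a,b], so the interval is clipped to it;
        both length functions are unaffected by clipping.\<close>
      define u' v' where "u' = max a (min b u)" "v' = max a (min b v)"
      have uv': "u' = max a u" "v' = min b v" "a \<le> u'" "u' \<le> x" "x \<le> v'" "v' \<le> b" "u \<le> u'" "v' \<le> v"
        using uv 3 by (auto simp: u'_v'_def)
      have near: "dist (g p) (g q) < r" if "p \<in> {u'..v'}" "q \<in> {u'..v'}" for p q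
      proof -
        have "dist p x < d" "dist q x < d" using that uv uv' by (auto simp: dist_real_def)
        then have "dist (g p) (g x) < r / 2" "dist (g q) (g x) < r / 2"
          using that uv' d(2)[of p] d(2)[of q] by auto
        then show ?thesis using dist_triangle2[of "g p" "g q" "g x"] by simp
      qed
      \<comment> \<open>A majorant for both kinds of pieces: the first summand pays for pieces that
        miss \<open>T\<close>, the second for pieces that meet it.\<close>
      define H where "H y = measure g.M ({u'<..y} - T) + h.F y / c" for y
      have "seg_length g u' v' \<le> ennreal (H v' - H u')"
      proof (rule seg_length_le_additive)
        fix p q assume pq: "u' \<le> p" "p \<le> q" "q \<le> v'"
        have "({u'<..p} - T) \<union> ({p<..q} - T) = {u'<..q} - T" using pq by auto
        then have split: "measure g.M ({u'<..q} - T) = measure g.M ({u'<..p} - T) + measure g.M ({p<..q} - T)"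
          using T by (subst Mg.finite_measure_Union[symmetric]) auto
        show "dist (g q) (g p) \<le> H q - H p"
        proof (cases "{p<..q} \<inter> T = {}")
          case True
          then have "{p<..q} - T = {p<..q}" by auto
          then have "dist (g q) (g p) \<le> measure g.M ({p<..q} - T)"
            using pq uv' by (simp add: g.measure_length_Ioc g.dist_le_seg_fun)
          moreover have "h.F p / c \<le> h.F q / c"
            using h.seg_fun_mono pq \<open>c > 0\<close> by (intro divide_right_mono) auto
          ultimately show ?thesis by (simp add: H_def split)
        next
          case False
          then obtain s where s: "s \<in> T" "p < s" "s \<le> q" by auto
          have "c * dist (g q) (g s) \<le> dist (h q) (h s)"
            using s pq uv' by (intro exp near) auto
          also have "\<dots> \<le> h.F q - h.F s"
            using s pq uv' by (intro h.dist_le_seg_fun) auto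
          finally have 1: "c * dist (g q) (g s) \<le> h.F q - h.F s" .
          have "c * dist (g p) (g s) \<le> dist (h p) (h s)"
            using s pq uv' by (intro exp near) auto
          also have "\<dots> \<le> h.F s - h.F p"
            using s pq uv' by (subst dist_commute, intro h.dist_le_seg_fun) auto
          finally have 2: "c * dist (g p) (g s) \<le> h.F s - h.F p" .
          have "c * dist (g q) (g p) \<le> c * (dist (g q) (g s) + dist (g p) (g s))"
            using \<open>c > 0\<close> dist_triangle2[of "g q" "g p" "g s"] by (intro mult_left_mono) auto
          also have "\<dots> \<le> h.F q - h.F p" using 1 2 by (simp add: distrib_left)
          finally have "dist (g q) (g p) \<le> h.F q / c - h.F p / c"
            using \<open>c > 0\<close> by (simp add: pos_le_divide_eq mult.commute flip: diff_divide_distrib)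
          then show ?thesis by (simp add: H_def split add_increasing2 add_increasing)
        qed
      qed (use uv' in auto)
      then have "ennreal (g.F v' - g.F u') \<le> ennreal (H v' - H u')"
        using uv' by (subst (asm) g.seg_fun_diff) auto
      moreover have "H u' \<le> H v'"
        unfolding H_def using uv' \<open>c > 0\<close> T
        by (intro add_mono Mg.finite_measure_mono divide_right_mono h.seg_fun_mono) auto
      ultimately have "measure g.M {u'<..v'} \<le> measure g.M ({u'<..v'} - T) + (h.F v' - h.F u') / c"
        using uv' by (simp add: g.measure_length_Ioc H_def ennreal_le_iff diff_divide_distrib)
      \<comment> \<open>The length outside \<open>T\<close> now occurs on both sides; it is finite
        and cancels, leaving the length inside \<open>T\<close>.\<close>
      moreover have "measure g.M ({u'<..v'} - T) = measure g.M {u'<..v'} - measure g.M ({u'<..v'} \<inter> T)"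
        using T by (intro Mg.finite_measure_Diff') auto
      ultimately have "measure g.M ({u'<..v'} \<inter> T) \<le> (h.F v' - h.F u') / c" by simp
      moreover have "h.F v' = h.F v" "h.F u' = h.F u" "g.F v' = g.F v" "g.F u' = g.F u"
        by (simp_all add: u'_v'_def h.seg_fun_clip g.seg_fun_clip)
      moreover have "measure g.M ({u<..v} \<inter> T) \<le> measure g.M ({u'<..v'} \<inter> T) + measure g.M ({u<..v} - {u'<..v'})"
        using T by (intro order_trans[OF Mg.finite_measure_mono measure_Un_le]) auto
      \<comment> \<open>The part removed by clipping carries no length, because the length function
        is constant outside [a,b].\<close>
      moreover have "measure g.M ({u<..v} - {u'<..v'}) = 0"
        using uv' uv calculation(2-) by (subst Mg.finite_measure_Diff) (auto simp: g.measure_length_Ioc)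
      ultimately show ?thesis by simp
    qed
    then show ?thesis using d(1) by blast
  qed
qed

text \<open>The estimate on half-open intervals says that the length of \<open>g\<close> restricted
  to \<open>T\<close> is dominated by the rescaled length of \<open>h\<close>. Both are finite
  measures, so regularity extends the domination to all Borel sets.\<close>

lemma emeasure_length_le_of_locally_expanding:
  fixes g :: "real \<Rightarrow> 'a::metric_space" and h :: "real \<Rightarrow> 'b::metric_space"
  assumes g: "rectifiable_path g a b" and h: "rectifiable_path h a b"
    and T: "T \<in> sets borel" "T \<subseteq> {a..b}" and "c > 0" "r > 0"
    and exp: "\<And>s t. s \<in> T \<Longrightarrow> t \<in> {a..b} \<Longrightarrow> dist (g t) (g s) < r
      \<Longrightarrow> c * dist (g t) (g s) \<le> dist (h t) (h s)"
    and A: "A \<in> sets borel"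
  shows "emeasure (interval_measure (seg_fun g a b)) (A \<inter> T)
    \<le> ennreal (1 / c) * emeasure (interval_measure (seg_fun h a b)) A"
proof -
  interpret g: rectifiable_path g a b by (rule g)
  interpret h: rectifiable_path h a b by (rule h)
  interpret Mg: finite_measure g.M by (rule g.finite_measure_length)
  let ?N1 = "density g.M (indicator T)" and ?N2 = "scale_measure (ennreal (1 / c)) h.M"
  have N1: "emeasure ?N1 A = emeasure g.M (A \<inter> T)" if "A \<in> sets borel" for A
    using that T by (subst emeasure_density) (auto simp: nn_integral_indicator Int_commute simp flip: indicator_inter_arith)
  have "emeasure ?N1 A \<le> emeasure ?N2 A"
  proof (rule measure_le_if_le_half_open)
    show "emeasure ?N1 UNIV \<noteq> \<infinity>"
      by (subst N1) (auto simp: Mg.emeasure_eq_measure)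
    show "emeasure ?N2 UNIV \<noteq> \<infinity>"
      using h.emeasure_length_finite by (simp add: ennreal_mult_eq_top_iff)
    fix u v :: real assume uv: "u \<le> v"
    have "emeasure ?N1 {u<..v} = ennreal (measure g.M ({u<..v} \<inter> T))"
      by (subst N1) (auto simp: Mg.emeasure_eq_measure)
    also have "\<dots> \<le> ennreal ((h.F v - h.F u) / c)"
      using measure_length_le_of_locally_expanding[OF g h T \<open>c > 0\<close> \<open>r > 0\<close> exp uv] by (rule ennreal_leI)
    also have "\<dots> = emeasure ?N2 {u<..v}"
      using uv \<open>c > 0\<close> h.seg_fun_mono[OF uv]
      by (simp add: h.emeasure_length_Ioc ennreal_mult[symmetric])
    finally show "emeasure ?N1 {u<..v} \<le> emeasure ?N2 {u<..v}" .
  qed (use A in auto)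
  then show ?thesis using A by (simp add: N1)
qed

section \<open>Signed length and absolute continuity of length measures\<close>

lemma signed_length_diff:
  assumes I: "is_interval (fst \<gamma>)" and rect: "loc_rectifiable \<gamma>"
    and t: "a \<in> fst \<gamma>" "t \<in> fst \<gamma>" "a \<le> t"
  shows "signed_length \<gamma> t = signed_length \<gamma> a + enn2real (seg_length (snd \<gamma>) a t)"
proof -
  define p where "p = base_pt \<gamma>"
  have p: "p \<in> fst \<gamma>" unfolding p_def base_pt_def using t(1) by (rule someI[of _ a])
  have fin: "seg_length (snd \<gamma>) x y < top" if "x \<in> fst \<gamma>" "y \<in> fst \<gamma>" "x \<le> y" for x y
    using rect that unfolding loc_rectifiable_def by auto
  consider "p \<le> a" | "a < p" "p \<le> t" | "t < p" by linarith
  then show ?thesis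
  proof cases
    case 1
    then show ?thesis
      using t p seg_length_add[of p a t "snd \<gamma>"] fin
      by (simp add: signed_length_def p_def[symmetric] enn2real_plus)
  next
    case 2
    then show ?thesis
      using t p seg_length_add[of a p t "snd \<gamma>"] fin
      by (simp add: signed_length_def p_def[symmetric] enn2real_plus)
  next
    case 3
    then show ?thesis
      using t p seg_length_add[of a t p "snd \<gamma>"] fin
      by (simp add: signed_length_def p_def[symmetric] enn2real_plus)
  qed
qed

lemma curve_segment:
  assumes "is_curve \<gamma>" "a \<in> fst \<gamma>" "b \<in> fst \<gamma>"
  shows "{a..b} \<subseteq> fst \<gamma>" "continuous_on {a..b} (snd \<gamma>)"
proof -
  show "{a..b} \<subseteq> fst \<gamma>"
    using assms mem_is_interval_1_I[of "fst \<gamma>" a b] unfolding is_curve_def by auto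
  then show "continuous_on {a..b} (snd \<gamma>)"
    using assms continuous_on_subset unfolding is_curve_def by blast
qed

lemma rectifiable_path_of_curve:
  assumes "is_curve \<gamma>" "loc_rectifiable \<gamma>" "a \<in> fst \<gamma>" "b \<in> fst \<gamma>" "a \<le> b"
  shows "rectifiable_path (snd \<gamma>) a b"
  using assms curve_segment(2)[OF assms(1,3,4)] by unfold_locales (auto simp: loc_rectifiable_def)

text \<open>Up to additive constants, L_{\<gamma>,f} takes the length of \<gamma> to that of f o
  \<gamma>. A compact set without image length has a null image under \<open>h.F\<close>, and the
  preimage of this null set under L contains its image under \<open>g.F\<close>. Compact sets
  suffice by inner regularity.\<close>

lemma null_length_of_L_N_inv:
  fixes \<gamma> :: "'a::metric_space curve" and f :: "'a \<Rightarrow> 'b::metric_space"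
  assumes \<gamma>: "is_curve \<gamma>" "loc_rectifiable \<gamma>"
    and \<gamma>': "is_curve (fst \<gamma>, f \<circ> snd \<gamma>)" "loc_rectifiable (fst \<gamma>, f \<circ> snd \<gamma>)"
    and L: "L_N_inv f \<gamma>" and ab: "a \<in> fst \<gamma>" "b \<in> fst \<gamma>" "a \<le> b"
    and A: "A \<in> sets borel" "A \<subseteq> {a..b}"
    and null: "emeasure (interval_measure (seg_fun (f \<circ> snd \<gamma>) a b)) A = 0"
  shows "emeasure (interval_measure (seg_fun (snd \<gamma>) a b)) A = 0"
proof -
  interpret g: rectifiable_path "snd \<gamma>" a b
    using rectifiable_path_of_curve[OF \<gamma> ab] .
  interpret h: rectifiable_path "f \<circ> snd \<gamma>" a b
    using rectifiable_path_of_curve[OF \<gamma>'] ab by simp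
  have I: "is_interval (fst \<gamma>)" and sub: "{a..b} \<subseteq> fst \<gamma>"
    using \<gamma>(1) curve_segment(1)[OF \<gamma>(1) ab(1,2)] unfolding is_curve_def by auto
  \<comment> \<open>Signed length starts at an arbitrary base point, \<open>seg_fun\<close> at
    \<open>a\<close>; the constants \<open>C\<close> and \<open>C'\<close> translate between them,
    and translations preserve null sets.\<close>
  define C where "C = signed_length \<gamma> a"
  define C' where "C' = signed_length (fst \<gamma>, f \<circ> snd \<gamma>) a"
  have sg: "signed_length \<gamma> t = C + g.F t" if "t \<in> {a..b}" for t
    using signed_length_diff[OF I \<gamma>(2) ab(1), of t] that sub
    by (auto simp: C_def seg_fun_def max_absorb2 min_absorb2)
  have sh: "signed_length (fst \<gamma>, f \<circ> snd \<gamma>) t = C' + h.F t" if "t \<in> {a..b}" for t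
    using signed_length_diff[of "(fst \<gamma>, f \<circ> snd \<gamma>)", OF _ \<gamma>'(2), of a t] I ab that sub
    by (auto simp: C'_def seg_fun_def max_absorb2 min_absorb2)
  have "emeasure g.M K = 0" if K: "K \<subseteq> A" "compact K" for K
  proof (rule null_interval_measure_of_null_image)
    have "emeasure h.M K = 0"
      using null emeasure_mono[OF K(1), of h.M] A by simp
    then have "h.F ` K \<in> null_sets lebesgue"
      using K by (intro null_image_of_null_interval_measure h.seg_fun_mono h.continuous_seg_fun
          h.emeasure_length_finite)
    then have S: "(+) C' ` h.F ` K \<in> null_sets lebesgue"
      by (simp add: negligible_translation flip: negligible_iff_null_sets)
    have "signed_length \<gamma> ` {t \<in> fst \<gamma>. signed_length (fst \<gamma>, f \<circ> snd \<gamma>) t \<in> (+) C' ` h.F ` K}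
      \<in> null_sets lebesgue" (is "?X \<in> _")
      using L S unfolding L_N_inv_def by blast
    then have "negligible ?X" by (simp only: negligible_iff_null_sets)
    moreover have "(+) C ` g.F ` K \<subseteq> ?X"
    proof clarify
      fix t assume t: "t \<in> K"
      then have tab: "t \<in> {a..b}" using K A by auto
      have "C' + h.F t \<in> (+) C' ` h.F ` K" using t by blast
      then have "t \<in> {t \<in> fst \<gamma>. signed_length (fst \<gamma>, f \<circ> snd \<gamma>) t \<in> (+) C' ` h.F ` K}"
        unfolding sh[OF tab, symmetric] using tab sub by blast
      then show "C + g.F t \<in> ?X"
        unfolding sg[OF tab, symmetric] by (rule imageI)
    qed
    ultimately have "negligible ((+) C ` g.F ` K)"
      by (rule negligible_subset)
    then show "g.F ` K \<in> null_sets lebesgue"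
      using negligible_translation_rev negligible_iff_null_sets by blast
  qed (use K in \<open>auto intro: g.seg_fun_mono g.continuous_seg_fun\<close>)
  then have "(SUP K \<in> {K. K \<subseteq> A \<and> compact K}. emeasure g.M K) \<le> 0"
    by (intro SUP_least) auto
  moreover have "emeasure g.M A = (SUP K \<in> {K. K \<subseteq> A \<and> compact K}. emeasure g.M K)"
    using A g.emeasure_length_finite by (intro inner_regular) auto
  ultimately show ?thesis by simp
qed

section \<open>Change of variables for an arbitrary finite index type\<close>

text \<open>The change of variables results of the library require a well-ordered index type; the
  following copy of a finite type provides one.\<close>
typedef ('n::finite) wo_copy = "{..<CARD('n)}"
  by (rule exI[of _ 0]) simp

instantiation wo_copy :: (finite) "{finite, wellorder}"
begin

definition less_eq_wo_copy :: "'a wo_copy \<Rightarrow> 'a wo_copy \<Rightarrow> bool" where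
  "less_eq_wo_copy x y \<longleftrightarrow> Rep_wo_copy x \<le> Rep_wo_copy y"

definition less_wo_copy :: "'a wo_copy \<Rightarrow> 'a wo_copy \<Rightarrow> bool" where
  "less_wo_copy x y \<longleftrightarrow> Rep_wo_copy x < Rep_wo_copy y"

instance
proof
  show "finite (UNIV :: 'a wo_copy set)"
    using finite_imageD[of Rep_wo_copy UNIV] finite_subset[of "range Rep_wo_copy" "{..<CARD('a)}"]
      Rep_wo_copy by (auto simp: inj_on_def Rep_wo_copy_inject)
  fix P :: "'a wo_copy \<Rightarrow> bool" and a
  assume step: "\<And>x. (\<And>y. y < x \<Longrightarrow> P y) \<Longrightarrow> P x"
  show "P a"
  proof (rule measure_induct_rule[where f = Rep_wo_copy])
    fix x :: "'a wo_copy" assume "\<And>y. Rep_wo_copy y < Rep_wo_copy x \<Longrightarrow> P y"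
    then have "\<And>y. y < x \<Longrightarrow> P y" by (simp add: less_wo_copy_def)
    then show "P x" by (rule step)
  qed
qed (auto simp: less_eq_wo_copy_def less_wo_copy_def Rep_wo_copy_inject)

end

lemma ex_wo_copy_bij: "\<exists>\<sigma> :: 'n::finite wo_copy \<Rightarrow> 'n. bij \<sigma>"
proof -
  have "card (UNIV :: 'n wo_copy set) = CARD('n)"
    using type_definition.card[OF type_definition_wo_copy] by simp
  then show ?thesis
    by (intro finite_same_card_bij[of "UNIV :: 'n wo_copy set" "UNIV :: 'n set"]) auto
qed

definition wo_index :: "'n::finite wo_copy \<Rightarrow> 'n" where
  "wo_index = (SOME \<sigma>. bij \<sigma>)"

lemma bij_wo_index: "bij wo_index"
  unfolding wo_index_def using ex_wo_copy_bij by (rule someI_ex)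

lemma wo_index_inv [simp]: "wo_index (inv wo_index i) = i" "inv wo_index (wo_index j) = j"
  by (rule surj_f_inv_f[OF bij_is_surj[OF bij_wo_index]], rule inv_f_f[OF bij_is_inj[OF bij_wo_index]])

definition to_wo :: "real^'n \<Rightarrow> real^('n::finite wo_copy)" where
  "to_wo x = (\<chi> i. x $ wo_index i)"

definition of_wo :: "real^('n::finite wo_copy) \<Rightarrow> real^'n" where
  "of_wo y = (\<chi> i. y $ inv wo_index i)"

lemma to_of_wo [simp]: "to_wo (of_wo y) = y" "of_wo (to_wo x) = x"
  by (simp_all add: to_wo_def of_wo_def vec_eq_iff)

lemma to_wo_eq_iff [simp]: "to_wo x = to_wo y \<longleftrightarrow> x = y"
  by (metis to_of_wo(2))

lemma linear_to_wo: "linear to_wo" and linear_of_wo: "linear of_wo"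
  by (auto intro!: linearI simp: to_wo_def of_wo_def vec_eq_iff)

lemma bounded_linear_to_wo: "bounded_linear to_wo" and bounded_linear_of_wo: "bounded_linear of_wo"
  using linear_to_wo linear_of_wo linear_conv_bounded_linear by blast+

lemma measurable_to_wo [measurable]: "to_wo \<in> borel_measurable borel"
  and measurable_of_wo [measurable]: "of_wo \<in> borel_measurable borel"
  by (auto intro!: borel_measurable_continuous_onI linear_continuous_on
      bounded_linear_to_wo bounded_linear_of_wo)

text \<open>In the Leibniz formula, conjugation by \<open>\<sigma>\<close> is a bijection between
  the two permutation groups. It preserves signs and only reorders each product.\<close>

lemma det_reindex:
  fixes A :: "'a::comm_ring_1^'n^'n" and \<sigma> :: "'m::finite \<Rightarrow> 'n::finite"
  assumes "bij \<sigma>"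
  shows "det (\<chi> i j. A $ \<sigma> i $ \<sigma> j) = det A"
proof -
  let ?B = "\<chi> i j. A $ \<sigma> i $ \<sigma> j"
  let ?\<Phi> = "\<lambda>p. \<sigma> \<circ> p \<circ> inv \<sigma>"
  have s: "\<sigma> (inv \<sigma> x) = x" "inv \<sigma> (\<sigma> y) = y" for x y
    using assms by (simp_all add: bij_is_inj bij_is_surj surj_f_inv_f)
  have eq: "?\<Phi> p = map_permutation UNIV \<sigma> p" for p
    using assms by (auto simp: map_permutation_def restrict_id_def bij_is_surj fun_eq_iff)
  have bij: "bij_betw ?\<Phi> {p. p permutes UNIV} {p. p permutes UNIV}"
    by (rule bij_betwI[where g = "\<lambda>p. inv \<sigma> \<circ> p \<circ> \<sigma>"])
      (use assms in \<open>auto simp: s fun_eq_iff permutes_bij intro!: bij_imp_permutes bij_comp bij_imp_bij_inv\<close>)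
  have "det A = (\<Sum>p | p permutes (UNIV::'m set). of_int (sign (?\<Phi> p)) * (\<Prod>i\<in>UNIV. A $ i $ ?\<Phi> p i))"
    unfolding det_def by (rule sum.reindex_bij_betw[OF bij, symmetric])
  also have "\<dots> = (\<Sum>p | p permutes (UNIV::'m set). of_int (sign p) * (\<Prod>i\<in>UNIV. ?B $ i $ p i))"
  proof (intro sum.cong refl)
    fix p :: "'m \<Rightarrow> 'm" assume "p \<in> {p. p permutes UNIV}"
    then have p: "p permutes UNIV" by simp
    have "sign (?\<Phi> p) = sign p"
      unfolding eq using p assms by (intro sign_map_permutation) (auto simp: bij_is_inj)
    moreover have "(\<Prod>i\<in>UNIV. A $ i $ ?\<Phi> p i) = (\<Prod>i\<in>UNIV. A $ \<sigma> i $ ?\<Phi> p (\<sigma> i))"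
      using assms by (intro prod.reindex_bij_betw[symmetric])
    ultimately show "of_int (sign (?\<Phi> p)) * (\<Prod>i\<in>UNIV. A $ i $ ?\<Phi> p i)
      = of_int (sign p) * (\<Prod>i\<in>UNIV. ?B $ i $ p i)"
      by (simp add: s)
  qed
  also have "\<dots> = det ?B" unfolding det_def ..
  finally show ?thesis by simp
qed

lemma det_matrix_conjugate_wo:
  fixes L :: "real^'n \<Rightarrow> real^'n"
  shows "det (matrix (to_wo \<circ> L \<circ> of_wo)) = det (matrix L)"
proof -
  have "of_wo (axis j 1) = axis (wo_index j) (1::real)" for j :: "'n wo_copy"
    by (auto simp: of_wo_def axis_def vec_eq_iff)
  then have "matrix (to_wo \<circ> L \<circ> of_wo) = (\<chi> i j. matrix L $ wo_index i $ wo_index j)"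
    by (simp add: matrix_def to_wo_def)
  then show ?thesis by (simp add: det_reindex[OF bij_wo_index])
qed

text \<open>A permutation of the coordinates takes boxes to boxes with the same side lengths, and
  the values on boxes determine Lebesgue measure.\<close>

lemma distr_lborel_to_wo: "distr lborel borel (to_wo :: real^'n \<Rightarrow> _) = lborel"
proof (rule lborel_eqI[symmetric])
  fix l u :: "real^('n wo_copy)"
  assume lu: "\<And>b. b \<in> Basis \<Longrightarrow> l \<bullet> b \<le> u \<bullet> b"
  have comp: "l $ i \<le> u $ i" for i
    using lu[of "axis i 1"] by (simp add: inner_axis axis_in_Basis_iff)
  have "to_wo -` box l u = box (of_wo l) (of_wo u)"
    by (auto simp: mem_box_cart to_wo_def of_wo_def) (metis wo_index_inv)+
  moreover have "of_wo l \<bullet> b \<le> of_wo u \<bullet> b" if "b \<in> Basis" for b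
    using that comp by (auto simp: Basis_vec_def inner_axis of_wo_def)
  moreover have "(\<Prod>b\<in>Basis. (of_wo u - of_wo l) \<bullet> b) = (\<Prod>b\<in>Basis. (u - l) \<bullet> b)"
  proof -
    have B: "(\<Prod>b\<in>Basis. z \<bullet> b) = (\<Prod>i\<in>UNIV. z $ i)" for z :: "real^'m"
    proof -
      have "(\<Prod>b\<in>range (\<lambda>i. axis i (1::real) :: real^'m). z \<bullet> b) = (\<Prod>i\<in>UNIV. z \<bullet> axis i 1)"
        by (subst prod.reindex) (auto simp: inj_on_def axis_eq_axis)
      moreover have "Basis = range (\<lambda>i. axis i (1::real) :: real^'m)" by (auto simp: Basis_vec_def)
      ultimately have "(\<Prod>b\<in>Basis. z \<bullet> b) = (\<Prod>i\<in>UNIV. z \<bullet> axis i 1)"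
        by simp
      then show ?thesis by (simp add: inner_axis)
    qed
    show ?thesis
      unfolding B using prod.reindex_bij_betw[OF bij_wo_index, of "\<lambda>i. (of_wo u - of_wo l) $ i"]
      by (simp add: of_wo_def)
  qed
  ultimately show "emeasure (distr lborel borel to_wo) (box l u) = (\<Prod>b\<in>Basis. (u - l) \<bullet> b)"
    by (simp add: emeasure_distr emeasure_lborel_box_eq)
qed simp

lemma distr_lebesgue_lborel_to_wo: "distr lebesgue lborel (to_wo :: real^'n \<Rightarrow> _) = lborel"
proof -
  have "distr lebesgue lborel (to_wo :: real^'n \<Rightarrow> _) = distr lborel lborel to_wo"
    by (rule distr_completion) simp
  also have "\<dots> = distr lborel borel to_wo"
    by (rule distr_cong) auto
  finally show ?thesis by (simp only: distr_lborel_to_wo)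
qed

lemma distr_lebesgue_to_wo: "distr lebesgue lebesgue (to_wo :: real^'n \<Rightarrow> _) = lebesgue"
  using completion.completion_distr_eq[of "to_wo :: real^'n \<Rightarrow> _" lborel lborel]
  by (simp add: distr_lebesgue_lborel_to_wo measurable_completion)

lemma measurable_lebesgue_to_wo: "(to_wo :: real^'n \<Rightarrow> _) \<in> lebesgue \<rightarrow>\<^sub>M lebesgue"
  by (rule completion.measurable_completion2)
    (simp_all add: distr_lebesgue_lborel_to_wo measurable_completion)

text \<open>Lipschitz maps into a space of no smaller dimension preserve null sets. As both index
  types have equally many elements, this applies to \<open>to_wo\<close> and to
  \<open>of_wo\<close>.\<close>

lemma negligible_bounded_linear_image:
  fixes g :: "'a::euclidean_space \<Rightarrow> 'b::euclidean_space"
  assumes g: "bounded_linear g" and dim: "DIM('a) \<le> DIM('b)" and S: "negligible S"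
  shows "negligible (g ` S)"
proof -
  obtain B where B: "\<And>x. norm (g x) \<le> norm x * B"
    using bounded_linear.bounded[OF g] by auto
  have "norm (g y - g x) \<le> B * norm (y - x)" for x y
    using B[of "y - x"] by (simp add: linear_diff[OF bounded_linear.linear[OF g]] mult.commute)
  then show ?thesis
    using dim S by (intro negligible_locally_Lipschitz_image) blast+
qed

lemma card_wo_copy: "CARD('n::finite wo_copy) = CARD('n)"
  using bij_betw_same_card[OF bij_wo_index] .

lemma to_wo_image_eq: "to_wo ` S = of_wo -` S"
  by (auto intro: image_eqI[of _ to_wo "of_wo _"])

lemma has_derivative_conjugate_wo:
  assumes "(f has_derivative f') (at x within S)"
  shows "(to_wo \<circ> f \<circ> of_wo has_derivative to_wo \<circ> f' \<circ> of_wo) (at (to_wo x) within to_wo ` S)"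
proof -
  have "(f has_derivative f') (at (of_wo (to_wo x)) within of_wo ` to_wo ` S)"
    using assms by (simp add: image_image)
  then have "(f \<circ> of_wo has_derivative f' \<circ> of_wo) (at (to_wo x) within to_wo ` S)"
    by (intro diff_chain_within[OF bounded_linear_imp_has_derivative[OF bounded_linear_of_wo]])
  from diff_chain_within[OF this bounded_linear_imp_has_derivative[OF bounded_linear_to_wo]]
  show ?thesis by (simp add: comp_assoc)
qed

text \<open>This is Sard's theorem in equal dimensions, where vanishing determinant means deficient
  rank. It is applied to the conjugate of \<open>f\<close> by the reindexing and then carried
  back.\<close>

lemma negligible_image_det_zero:
  fixes f :: "real^'n \<Rightarrow> real^'n"
  assumes der: "\<And>x. x \<in> S \<Longrightarrow> (f has_derivative f' x) (at x within S)"
    and det: "\<And>x. x \<in> S \<Longrightarrow> det (matrix (f' x)) = 0"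
  shows "negligible (f ` S)"
proof -
  let ?f = "to_wo \<circ> f \<circ> of_wo"
  have "negligible (?f ` (to_wo ` S))"
  proof (rule baby_Sard)
    fix y assume "y \<in> to_wo ` S"
    then obtain x where x: "x \<in> S" "y = to_wo x" by auto
    show "(?f has_derivative to_wo \<circ> f' (of_wo y) \<circ> of_wo) (at y within to_wo ` S)"
      using has_derivative_conjugate_wo[OF der[OF x(1)]] x by simp
    show "rank (matrix (to_wo \<circ> f' (of_wo y) \<circ> of_wo)) < CARD('n wo_copy)"
      using det[OF x(1)] x by (simp add: det_matrix_conjugate_wo flip: det_eq_0_rank)
  qed simp
  then have "negligible (of_wo ` ?f ` (to_wo ` S))"
    by (rule negligible_bounded_linear_image[OF bounded_linear_of_wo, rotated]) (simp add: card_wo_copy)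
  then show ?thesis by (simp add: image_image)
qed

lemma lebesgue_to_wo_image:
  fixes S :: "(real^'n) set"
  assumes "S \<in> sets lebesgue"
  shows "to_wo ` S \<in> sets lebesgue"
proof -
  obtain B N N' where S: "S = B \<union> N" "N \<subseteq> N'" "N' \<in> null_sets lborel" "B \<in> sets lborel"
    using assms by (rule sets_completionE)
  have "N \<in> null_sets lebesgue"
    using S by (metis null_sets_completionI null_sets_completion_subset)
  then have "negligible (to_wo ` N)"
    by (intro negligible_bounded_linear_image bounded_linear_to_wo)
      (simp_all add: card_wo_copy negligible_iff_null_sets)
  moreover have "to_wo ` B \<in> sets lebesgue"
    unfolding to_wo_image_eq using measurable_sets[OF measurable_of_wo, of B] S by simp
  ultimately show ?thesis
    unfolding S image_Un by (intro sets.Un) (auto simp: negligible_iff_null_sets)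
qed

lemma measurable_det_derivative:
  fixes f :: "real^'n \<Rightarrow> real^'n"
  assumes S: "S \<in> sets lebesgue" and der: "\<And>x. x \<in> S \<Longrightarrow> (f has_derivative f' x) (at x within S)"
  shows "(\<lambda>x. det (matrix (f' x))) \<in> borel_measurable (lebesgue_on S)"
proof -
  let ?f = "to_wo \<circ> f \<circ> of_wo"
  let ?J = "\<lambda>y. det (matrix (to_wo \<circ> f' (of_wo y) \<circ> of_wo))"
  have "?J \<in> borel_measurable (lebesgue_on (to_wo ` S))"
  proof (rule borel_measurable_det_Jacobian)
    fix y assume "y \<in> to_wo ` S"
    then obtain x where x: "x \<in> S" "y = to_wo x" by auto
    show "(?f has_derivative to_wo \<circ> f' (of_wo y) \<circ> of_wo) (at y within to_wo ` S)"
      using has_derivative_conjugate_wo[OF der[OF x(1)]] x by simp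
  qed (rule lebesgue_to_wo_image[OF S])
  moreover have "to_wo \<in> lebesgue_on S \<rightarrow>\<^sub>M lebesgue_on (to_wo ` S)"
    by (rule measurable_restrict_space3[OF measurable_lebesgue_to_wo]) auto
  ultimately have "(\<lambda>x. ?J (to_wo x)) \<in> borel_measurable (lebesgue_on S)"
    by (rule measurable_compose[rotated])
  then show ?thesis by (simp add: det_matrix_conjugate_wo)
qed

text \<open>Nothing is to be shown when the right side is infinite. Otherwise the Jacobian is
  integrable, and the inequality for real-valued integrals applies.\<close>

lemma emeasure_differentiable_image_le_wo:
  fixes f :: "real^'n::{finite,wellorder} \<Rightarrow> real^'n::_"
  assumes S: "S \<in> sets lebesgue" and der: "\<And>x. x \<in> S \<Longrightarrow> (f has_derivative f' x) (at x within S)"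
  shows "emeasure lebesgue (f ` S) \<le> (\<integral>\<^sup>+x\<in>S. ennreal \<bar>det (matrix (f' x))\<bar> \<partial>lebesgue)"
proof (cases "(\<integral>\<^sup>+x\<in>S. ennreal \<bar>det (matrix (f' x))\<bar> \<partial>lebesgue) = \<infinity>")
  case False
  let ?J = "\<lambda>x. \<bar>det (matrix (f' x))\<bar>"
  have m: "?J \<in> borel_measurable (lebesgue_on S)"
    by (intro borel_measurable_abs borel_measurable_det_Jacobian[OF S der])
  have nn: "(\<integral>\<^sup>+x. ennreal (?J x) \<partial>lebesgue_on S) = (\<integral>\<^sup>+x\<in>S. ennreal (?J x) \<partial>lebesgue)"
    using S by (simp add: nn_integral_restrict_space)
  have int: "integrable (lebesgue_on S) ?J"
    using False by (intro integrableI_bounded m) (simp add: nn less_top)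
  then have "?J absolutely_integrable_on S"
    using S integrable_restrict_space[of S lebesgue ?J] by (simp add: set_integrable_def)
  then have J: "?J integrable_on S" "integral S ?J = integral\<^sup>L (lebesgue_on S) ?J"
    using int S by (auto simp: set_lebesgue_integral_eq_integral lebesgue_integral_eq_integral)
  have "f ` S \<in> lmeasurable" "measure lebesgue (f ` S) \<le> integral S ?J"
    using measurable_differentiable_image[OF S der J(1)] measure_differentiable_image[OF S der J(1)] by auto
  then have "emeasure lebesgue (f ` S) \<le> ennreal (integral S ?J)"
    by (simp add: emeasure_eq_measure2 ennreal_leI)
  also have "\<dots> = (\<integral>\<^sup>+x\<in>S. ennreal (?J x) \<partial>lebesgue)"
    unfolding J(2) nn[symmetric] by (rule nn_integral_eq_integral[symmetric, OF int]) auto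
  finally show ?thesis .
qed simp

lemma emeasure_differentiable_image_le:
  fixes f :: "real^'n \<Rightarrow> real^'n"
  assumes S: "S \<in> sets lebesgue" and der: "\<And>x. x \<in> S \<Longrightarrow> (f has_derivative f' x) (at x within S)"
    and meas: "f ` S \<in> sets lebesgue"
  shows "emeasure lebesgue (f ` S) \<le> (\<integral>\<^sup>+x\<in>S. ennreal \<bar>det (matrix (f' x))\<bar> \<partial>lebesgue)"
proof -
  let ?f = "to_wo \<circ> f \<circ> of_wo"
  let ?J = "\<lambda>y. det (matrix (to_wo \<circ> f' (of_wo y) \<circ> of_wo))"
  have em: "emeasure lebesgue (to_wo ` A) = emeasure lebesgue A" if "A \<in> sets lebesgue" for A :: "(real^'n) set"
  proof -
    have "emeasure lebesgue (to_wo ` A) = emeasure (distr lebesgue lebesgue to_wo) (to_wo ` A)"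
      by (simp only: distr_lebesgue_to_wo)
    also have "\<dots> = emeasure lebesgue (to_wo -` (to_wo ` A) \<inter> space lebesgue)"
      by (rule emeasure_distr[OF measurable_lebesgue_to_wo lebesgue_to_wo_image[OF that]])
    also have "to_wo -` (to_wo ` A) \<inter> space lebesgue = A"
      by auto
    finally show ?thesis .
  qed
  have der': "(?f has_derivative to_wo \<circ> f' (of_wo y) \<circ> of_wo) (at y within to_wo ` S)"
    if y: "y \<in> to_wo ` S" for y
  proof -
    obtain x where x: "x \<in> S" "y = to_wo x" using y by auto
    show ?thesis
      using has_derivative_conjugate_wo[OF der[OF x(1)]] x by simp
  qed
  have "emeasure lebesgue (f ` S) = emeasure lebesgue (?f ` to_wo ` S)"
    using em[OF meas] by (simp add: image_image)
  also have "\<dots> \<le> (\<integral>\<^sup>+y\<in>to_wo ` S. ennreal \<bar>?J y\<bar> \<partial>lebesgue)"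
    by (rule emeasure_differentiable_image_le_wo[OF lebesgue_to_wo_image[OF S] der'])
  also have "\<dots> = (\<integral>\<^sup>+y\<in>to_wo ` S. ennreal \<bar>?J y\<bar> \<partial>distr lebesgue lebesgue to_wo)"
    by (simp only: distr_lebesgue_to_wo)
  also have "\<dots> = (\<integral>\<^sup>+x. ennreal \<bar>?J (to_wo x)\<bar> * indicator (to_wo ` S) (to_wo x) \<partial>lebesgue)"
  proof (rule nn_integral_distr[OF measurable_lebesgue_to_wo])
    have "(\<lambda>y. ennreal \<bar>?J y\<bar>) \<in> borel_measurable (lebesgue_on (to_wo ` S))"
      using borel_measurable_det_Jacobian[OF lebesgue_to_wo_image[OF S] der'] by measurable
    then have "(\<lambda>y. ennreal \<bar>?J y\<bar> * indicator (to_wo ` S) y) \<in> borel_measurable lebesgue"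
      using lebesgue_to_wo_image[OF S] by (subst borel_measurable_restrict_space_iff_ennreal[symmetric]) auto
    then show "(\<lambda>y. ennreal \<bar>?J y\<bar> * indicator (to_wo ` S) y)
        \<in> borel_measurable (distr lebesgue lebesgue to_wo)"
      by (simp only: measurable_distr_eq1)
  qed
  also have "\<dots> = (\<integral>\<^sup>+x\<in>S. ennreal \<bar>det (matrix (f' x))\<bar> \<partial>lebesgue)"
    by (intro nn_integral_cong)
      (auto simp: det_matrix_conjugate_wo indicator_def image_iff to_wo_eq_iff)
  finally show ?thesis .
qed

lemma nn_integral_mono_measure:
  assumes sets: "sets M = sets N" and le: "\<And>A. A \<in> sets M \<Longrightarrow> emeasure M A \<le> emeasure N A"
  shows "integral\<^sup>N M h \<le> integral\<^sup>N N h"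
  unfolding nn_integral_def
proof (rule SUP_mono)
  have space: "space M = space N" using sets by (rule sets_eq_imp_space_eq)
  fix g assume g: "g \<in> {g. simple_function M g \<and> g \<le> h}"
  then have "simple_function N g"
    by (simp add: simple_function_def sets space)
  moreover have "integral\<^sup>S M g \<le> integral\<^sup>S N g"
    unfolding simple_integral_def space
    using g by (intro sum_mono mult_left_mono le) (auto simp: simple_function_def space)
  ultimately show "\<exists>g'\<in>{g. simple_function N g \<and> g \<le> h}. integral\<^sup>S M g \<le> integral\<^sup>S N g'"
    using g by auto
qed

text \<open>Both sides integrate \<open>h\<close>: the left against Lebesgue measure on the image,
  the right against the push-forward of |J| dm. The bound for images of the sets S \<inter>
  f^{-1}(A) compares these measures. The push-forward counts multiplicity, hence an
  inequality.\<close>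

lemma nn_integral_differentiable_image_le:
  fixes f :: "real^'n \<Rightarrow> real^'n"
  assumes S: "S \<in> sets borel" and der: "\<And>x. x \<in> S \<Longrightarrow> (f has_derivative f' x) (at x within S)"
    and fS: "f ` S \<in> sets borel" and h: "h \<in> borel_measurable borel"
  shows "(\<integral>\<^sup>+y\<in>f ` S. h y \<partial>lborel) \<le> (\<integral>\<^sup>+x\<in>S. ennreal \<bar>det (matrix (f' x))\<bar> * h (f x) \<partial>lebesgue)"
proof -
  let ?J = "\<lambda>x. ennreal \<bar>det (matrix (f' x))\<bar>"
  \<comment> \<open>The values of \<open>f\<close> off \<open>S\<close> are arbitrary; zero there
    makes the map Borel on the whole space, as a push-forward requires.\<close>
  define f0 where "f0 x = (if x \<in> S then f x else 0)" for x
  have "continuous_on S f"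
    using der has_derivative_continuous continuous_on_eq_continuous_within by blast
  then have f0: "f0 \<in> borel_measurable borel"
    unfolding f0_def using S
    by (intro borel_measurable_continuous_on_if) auto
  then have f0L: "f0 \<in> borel_measurable lebesgue"
    by (simp add: measurable_completion)
  have SL: "S \<in> sets lebesgue" using S by simp
  have J: "(\<lambda>x. ?J x * indicator S x) \<in> borel_measurable lebesgue"
  proof -
    have "?J \<in> borel_measurable (lebesgue_on S)"
      using measurable_det_derivative[OF SL der] by measurable
    then show ?thesis
      using SL by (subst borel_measurable_restrict_space_iff_ennreal[symmetric]) auto
  qed
  let ?N1 = "density lborel (indicator (f ` S))"
  let ?N2 = "distr (density lebesgue (\<lambda>x. ?J x * indicator S x)) borel f0"
  have "emeasure ?N1 A \<le> emeasure ?N2 A" if "A \<in> sets ?N1" for A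
  proof -
    have A: "A \<in> sets borel" using that by simp
    define SA where "SA = S \<inter> f0 -` A"
    have SA: "SA \<in> sets borel" "SA \<subseteq> S"
      using S measurable_sets[OF f0 A] by (auto simp: SA_def)
    have im: "f ` SA = f ` S \<inter> A" by (auto simp: SA_def f0_def)
    have "emeasure ?N1 A = emeasure lebesgue (f ` SA)"
      unfolding im using A fS
      by (subst emeasure_density) (auto simp: nn_integral_indicator simp flip: indicator_inter_arith)
    also have "\<dots> \<le> (\<integral>\<^sup>+x\<in>SA. ?J x \<partial>lebesgue)"
    proof (rule emeasure_differentiable_image_le)
      show "f ` SA \<in> sets lebesgue" unfolding im using A fS by simp
    qed (use SA der has_derivative_subset in \<open>auto, blast\<close>)
    also have "\<dots> = (\<integral>\<^sup>+x. ?J x * indicator S x * indicator (f0 -` A \<inter> space lebesgue) x \<partial>lebesgue)"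
      by (intro nn_integral_cong) (auto simp: SA_def indicator_def)
    also have "\<dots> = emeasure ?N2 A"
      using A f0L J measurable_sets[OF f0L A]
      by (subst emeasure_distr, simp, simp, subst emeasure_density) auto
    finally show ?thesis .
  qed
  then have "integral\<^sup>N ?N1 h \<le> integral\<^sup>N ?N2 h"
    by (intro nn_integral_mono_measure) auto
  moreover have "integral\<^sup>N ?N1 h = (\<integral>\<^sup>+y\<in>f ` S. h y \<partial>lborel)"
    using fS h by (subst nn_integral_density) (auto simp: mult.commute)
  moreover have "integral\<^sup>N ?N2 h = (\<integral>\<^sup>+x\<in>S. ?J x * h (f x) \<partial>lebesgue)"
  proof -
    have "integral\<^sup>N ?N2 h = (\<integral>\<^sup>+x. h (f0 x) \<partial>density lebesgue (\<lambda>x. ?J x * indicator S x))"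
      using f0L h by (subst nn_integral_distr) auto
    also have "\<dots> = (\<integral>\<^sup>+x. ?J x * indicator S x * h (f0 x) \<partial>lebesgue)"
      using J measurable_compose[OF f0L h] by (rule nn_integral_density)
    also have "\<dots> = (\<integral>\<^sup>+x\<in>S. ?J x * h (f x) \<partial>lebesgue)"
      by (intro nn_integral_cong) (auto simp: indicator_def f0_def)
    finally show ?thesis .
  qed
  ultimately show ?thesis by simp
qed

section \<open>Powers of extended nonnegative reals\<close>

lemma epow_mono:
  assumes "q > 0" "x \<le> y"
  shows "epow x q \<le> epow y q"
proof (cases "y = \<infinity>")
  case False
  then have "x \<noteq> \<infinity>" using assms by (auto simp: top_unique)
  then show ?thesis
    using False assms by (auto simp: epow_def less_top intro!: ennreal_leI powr_mono2 enn2real_mono)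
qed (simp add: epow_def)

lemma epow_inverse: "q > 0 \<Longrightarrow> epow (epow x (1 / q)) q = x"
  by (cases x) (auto simp: epow_def powr_powr)

lemma epow_cmult:
  assumes "c > 0"
  shows "epow (ennreal c * x) q = ennreal (c powr q) * epow x q"
proof (cases x)
  case (real r)
  have "ennreal c * x = ennreal (c * r)"
    using real assms by (simp only: ennreal_mult less_imp_le)
  then have "epow (ennreal c * x) q = ennreal ((c * r) powr q)"
    using real assms by (simp only: epow_def) simp
  also have "\<dots> = ennreal (c powr q) * ennreal (r powr q)"
    by (simp only: powr_mult) (rule ennreal_mult, auto)
  finally show ?thesis
    using real by (simp add: epow_def)
next
  case top
  have "ennreal c * top = top" "ennreal (c powr q) * top = top"
    using assms by (auto simp: ennreal_mult_top)
  then show ?thesis using top by (simp only: epow_def) simp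
qed

lemma epow_le_if_le_inverse:
  assumes "q > 0" "x \<le> epow s (1 / q)"
  shows "epow x q \<le> s"
  using epow_mono[OF assms] by (simp add: epow_inverse assms(1))

lemma le_epow_inverse_if:
  assumes "q > 0" "epow x q \<le> s"
  shows "x \<le> epow s (1 / q)"
  using epow_mono[of "1 / q", OF _ assms(2)] epow_inverse[of "1 / q" x] assms(1) by simp

text \<open>The inverse power \<open>1 / q\<close> turns the common bound on the powers into a
  common bound on the terms, which then passes to the supremum.\<close>

lemma epow_SUP_le:
  assumes "q > 0" "\<And>i. i \<in> I \<Longrightarrow> epow (a i) q \<le> s"
  shows "epow (SUP i\<in>I. a i) q \<le> s"
  by (rule epow_le_if_le_inverse[OF assms(1)], rule SUP_least, rule le_epow_inverse_if[OF assms])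

lemma epow_max_le: "q > 0 \<Longrightarrow> epow (max x y) q \<le> epow x q + epow y q"
  by (cases "x \<le> y") (auto simp: max_def add_increasing add_increasing2)

lemma measurable_epow [measurable]: "(\<lambda>x. epow x q) \<in> borel_measurable borel"
  unfolding epow_def by measurable

lemma epow_0 [simp]: "epow 0 q = 0"
  by (simp add: epow_def)

section \<open>Decomposition into expanding pieces\<close>

lemma min_stretch_le:
  fixes L :: "real^'n \<Rightarrow> real^'n"
  assumes "norm h = 1"
  shows "min_stretch L \<le> norm (L h)"
  unfolding min_stretch_def using assms by (intro cInf_lower bdd_belowI[of _ 0]) auto

lemma min_stretch_mult_norm_le:
  fixes L :: "real^'n \<Rightarrow> real^'n"
  assumes "linear L"
  shows "min_stretch L * norm h \<le> norm (L h)"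
proof (cases "h = 0")
  case False
  then have "min_stretch L \<le> norm (L (h /\<^sub>R norm h))"
    by (intro min_stretch_le) simp
  then show ?thesis
    using False by (simp add: linear_cmul[OF assms] field_simps)
qed (use assms linear_0 in auto)

lemma le_min_stretch:
  fixes L :: "real^'n \<Rightarrow> real^'n"
  assumes "\<And>h. norm h = 1 \<Longrightarrow> c \<le> norm (L h)"
  shows "c \<le> min_stretch L"
proof -
  obtain h :: "real^'n" where "norm h = 1" using vector_choose_size[of 1] by auto
  then show ?thesis unfolding min_stretch_def using assms by (intro cInf_greatest) auto
qed

lemma min_stretch_pos:
  fixes L :: "real^'n \<Rightarrow> real^'n"
  assumes "linear L" "det (matrix L) \<noteq> 0"
  shows "min_stretch L > 0"
proof -
  have "inj L" using assms det_nz_iff_inj by blast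
  then obtain B where "B > 0" "\<And>x. B * norm x \<le> norm (L x)"
    using linear_inj_bounded_below_pos assms(1) by blast
  then have "B \<le> min_stretch L" by (intro le_min_stretch) (metis mult.right_neutral)
  with \<open>B > 0\<close> show ?thesis by simp
qed

text \<open>The comparison point \<open>y\<close> ranges over all of \<open>D\<close>, since the
  points of a curve next to a point of a piece need not lie in the piece. Explicit constant and
  radius allow countably many pairs to serve all points.\<close>

definition expands_at :: "('a::metric_space \<Rightarrow> 'b::metric_space) \<Rightarrow> 'a set \<Rightarrow> real \<Rightarrow> real \<Rightarrow> 'a \<Rightarrow> bool" where
  "expands_at f D c r x \<longleftrightarrow> (\<forall>y\<in>D. dist y x < r \<longrightarrow> c * dist y x \<le> dist (f y) (f x))"

text \<open>Failure of expansion against a fixed \<open>y\<close> is a pair of strict inequalities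
  between continuous functions of \<open>x\<close>. The failing points thus form an open set,
  although the union over \<open>y\<close> is uncountable.\<close>

lemma borel_expands_at:
  fixes f :: "'a::metric_space \<Rightarrow> 'b::metric_space"
  assumes D: "open D" and f: "continuous_on D f"
  shows "{x \<in> D. expands_at f D c r x} \<in> sets borel"
proof -
  let ?U = "\<lambda>y. (D \<inter> (\<lambda>x. r - dist y x) -` {0<..}) \<inter> (D \<inter> (\<lambda>x. c * dist y x - dist (f y) (f x)) -` {0<..})"
  have "open (?U y)" for y
    using D f by (intro open_Int continuous_open_preimage continuous_intros) auto
  then have "open (\<Union>y\<in>D. ?U y)" by blast
  moreover have "{x \<in> D. expands_at f D c r x} = D - (\<Union>y\<in>D. ?U y)"
    by (auto simp: expands_at_def not_le)
  ultimately show ?thesis using D by simp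
qed

text \<open>The gap between \<open>c\<close> and the minimal stretching absorbs the remainder of the
  first-order expansion. Reciprocals of integers as radii keep the later decomposition
  countable.\<close>

lemma expands_at_of_derivative:
  fixes f :: "real^'n \<Rightarrow> real^'n"
  assumes der: "(f has_derivative L) (at x)" and c: "c < min_stretch L"
  shows "\<exists>m::nat. expands_at f D c (1 / real (Suc m)) x"
proof -
  have lin: "linear L" using der has_derivative_linear by blast
  obtain d where d: "d > 0" "\<And>y. norm (y - x) < d \<Longrightarrow>
      norm (f y - f x - L (y - x)) \<le> (min_stretch L - c) * norm (y - x)"
    using der c unfolding has_derivative_at_alt by (metis diff_gt_0_iff_gt)
  obtain m where m: "1 / real (Suc m) < d" using d(1) nat_approx_posE by blast
  have "c * dist y x \<le> dist (f y) (f x)" if "dist y x < 1 / real (Suc m)" for y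
  proof -
    have "norm (f y - f x - L (y - x)) \<le> (min_stretch L - c) * norm (y - x)"
      using that m d(2)[of y] by (simp add: dist_norm)
    moreover have "norm (L (y - x)) \<le> norm (f y - f x) + norm (f y - f x - L (y - x))"
      using norm_triangle_ineq4[of "f y - f x" "f y - f x - L (y - x)"] by simp
    moreover have "min_stretch L * norm (y - x) \<le> norm (L (y - x))"
      by (rule min_stretch_mult_norm_le[OF lin])
    ultimately show ?thesis by (simp add: dist_norm left_diff_distrib)
  qed
  then show ?thesis unfolding expands_at_def by blast
qed

text \<open>Together with its converse this describes the minimal stretching by expansion alone, so
  level sets of l(f'(x)) can be replaced by Borel sets given by \<open>expands_at\<close>.\<close>

lemma le_min_stretch_of_expands_at:
  fixes f :: "real^'n \<Rightarrow> real^'n"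
  assumes der: "(f has_derivative L) (at x)" and D: "open D" "x \<in> D"
    and "r > 0" and exp: "expands_at f D c r x"
  shows "c \<le> min_stretch L"
proof (rule le_min_stretch, rule field_le_epsilon)
  fix h :: "real^'n" and e :: real assume h: "norm h = 1" and e: "e > 0"
  have lin: "linear L" using der has_derivative_linear by blast
  obtain d where d: "d > 0" "\<And>y. norm (y - x) < d \<Longrightarrow> norm (f y - f x - L (y - x)) \<le> e * norm (y - x)"
    using der e unfolding has_derivative_at_alt by blast
  obtain s where s: "s > 0" "ball x s \<subseteq> D" using D openE by blast
  \<comment> \<open>This makes \<open>t\<close> smaller than the three radii: \<open>d\<close> for
    the remainder estimate, \<open>r\<close> for the expansion and \<open>s\<close> for staying
    inside \<open>D\<close>.\<close>
  define t where "t = min d (min r s) / 2"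
  have t: "t > 0" "t < d" "t < r" "t < s" using d s \<open>r > 0\<close> by (auto simp: t_def)
  let ?y = "x + t *\<^sub>R h"
  have y: "norm (?y - x) = t" using t h by simp
  have "?y \<in> D" using s t h by (auto simp: dist_norm)
  then have "c * t \<le> norm (f ?y - f x)"
    using exp y t unfolding expands_at_def by (force simp: dist_norm)
  moreover have "norm (f ?y - f x - L (?y - x)) \<le> e * t" using d(2)[of ?y] t y by simp
  moreover have "L (?y - x) = t *\<^sub>R L h" by (simp add: linear_cmul[OF lin])
  moreover have "norm (f ?y - f x) \<le> norm (L (?y - x)) + norm (f ?y - f x - L (?y - x))"
    using norm_triangle_ineq[of "L (?y - x)" "f ?y - f x - L (?y - x)"] by simp
  ultimately have "c * t \<le> t * norm (L h) + e * t" using t by simp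
  then have "t * c \<le> t * (norm (L h) + e)" by (simp add: algebra_simps)
  then show "c \<le> norm (L h) + e" using t by simp
qed

lemma ex_expanding_compact_pieces:
  fixes f :: "real^'n \<Rightarrow> real^'n"
  assumes D: "open D" and f: "continuous_on D f" and G: "G \<in> sets lebesgue" "G \<subseteq> D"
    and der: "\<And>x. x \<in> G \<Longrightarrow> (f has_derivative f' x) (at x)"
    and det: "\<And>x. x \<in> G \<Longrightarrow> det (matrix (f' x)) \<noteq> 0"
    and "\<kappa> > 1"
  obtains C :: "nat \<Rightarrow> (real^'n) set" and c r :: "nat \<Rightarrow> real"
  where "\<And>k. compact (C k)" "\<And>k. C k \<subseteq> G" "\<And>k. c k > 0" "\<And>k. r k > 0"
    "\<And>k x. x \<in> C k \<Longrightarrow> expands_at f D (c k) (r k) x" "\<And>k. inj_on f (C k)"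
    "\<And>k x. x \<in> C k \<Longrightarrow> min_stretch (f' x) \<le> \<kappa> * c k"
    "negligible (G - (\<Union>k. C k))"
proof -
  obtain X :: "(real^'n) set" where X: "countable X" "\<And>U. open U \<Longrightarrow> U \<noteq> {} \<Longrightarrow> \<exists>d\<in>X. d \<in> U"
    using countable_dense_setE by blast
  have Xne: "X \<noteq> {}" using X(2)[of UNIV] by auto
  define z where "z = from_nat_into X"
  \<comment> \<open>Nonpositive rationals are redirected to 1, so that every index yields a positive
    constant.\<close>
  define w :: "rat \<Rightarrow> real" where "w p = (if p > 0 then of_rat p else 1)" for p
  define s :: "nat \<Rightarrow> real" where "s m = 1 / real (Suc m)" for m
  have w: "w p > 0" for p by (simp add: w_def)
  have s: "s m > 0" for m by (simp add: s_def)
  let ?E = "\<lambda>c r. {x \<in> D. expands_at f D c r x}"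
  \<comment> \<open>Expansion with \<open>w p\<close> at one radius and failure of expansion with
    \<open>\<kappa> * w p\<close> at every radius pin the minimal stretching between these
    constants. The small ball is what yields injectivity.\<close>
  define P where "P i = (case i of (p, m, j) \<Rightarrow>
     G \<inter> (?E (w p) (s m) \<inter> ball (z j) (s m / 2) - (\<Union>m'. ?E (\<kappa> * w p) (s m'))))" for i :: "rat \<times> nat \<times> nat"
  have P_lebesgue: "P i \<in> sets lebesgue" for i
  proof -
    obtain p m j where i: "i = (p, m, j)" by (cases i)
    have "?E (w p) (s m) \<inter> ball (z j) (s m / 2) - (\<Union>m'. ?E (\<kappa> * w p) (s m')) \<in> sets borel"
      by (intro sets.Diff sets.Int sets.countable_UN) (auto intro!: borel_expands_at[OF D f])
    then show ?thesis unfolding i P_def prod.case using G(1) by (intro sets.Int) auto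
  qed
  \<comment> \<open>Up to a null set, a Lebesgue set is a countable union of compact sets;
    compactness will provide a continuous inverse on each piece.\<close>
  have "\<exists>K :: nat \<Rightarrow> (real^'n) set. (\<forall>n. compact (K n) \<and> K n \<subseteq> P i) \<and> P i - (\<Union>n. K n) \<in> null_sets lebesgue" for i
  proof -
    obtain C T where CT: "fsigma C" "T \<in> null_sets lebesgue" "C \<union> T = P i" "disjnt C T"
      using lebesgue_set_almost_fsigma[OF P_lebesgue] .
    then obtain K :: "nat \<Rightarrow> (real^'n) set" where K: "range K \<subseteq> Collect compact" "C = \<Union>(range K)"
      using fsigma_Union_compact by metis
    have "P i - (\<Union>n. K n) = T" using CT K by (auto simp: disjnt_def)
    moreover have "compact (K n)" for n using K(1) by blast
    moreover have "K n \<subseteq> P i" for n using CT(3) K(2) by blast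
    ultimately show ?thesis using CT(2) by (intro exI[of _ K]) auto
  qed
  then obtain K :: "rat \<times> nat \<times> nat \<Rightarrow> nat \<Rightarrow> (real^'n) set"
    where K: "\<And>i n. compact (K i n)" "\<And>i n. K i n \<subseteq> P i" "\<And>i. P i - (\<Union>n. K i n) \<in> null_sets lebesgue"
    by metis
  define \<iota> :: "nat \<Rightarrow> (rat \<times> nat \<times> nat) \<times> nat" where "\<iota> = from_nat"
  let ?p = "\<lambda>k. fst (fst (\<iota> k))" and ?m = "\<lambda>k. fst (snd (fst (\<iota> k)))"
  define C where "C k = K (fst (\<iota> k)) (snd (\<iota> k))" for k
  have CP: "C k \<subseteq> P (fst (\<iota> k))" for k using K(2) by (simp add: C_def)
  have inP: "x \<in> G" "x \<in> D" "expands_at f D (w (?p k)) (s (?m k)) x"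
    "dist (z (snd (snd (fst (\<iota> k))))) x < s (?m k) / 2"
    "\<not> expands_at f D (\<kappa> * w (?p k)) (s m') x" if "x \<in> C k" for x k m'
    using CP[of k] that by (auto simp: P_def split: prod.splits)
  show thesis
  proof (rule that[of C "\<lambda>k. w (?p k)" "\<lambda>k. s (?m k)"])
    fix k
    show "inj_on f (C k)"
    proof (rule inj_onI)
      fix x y assume xy: "x \<in> C k" "y \<in> C k" "f x = f y"
      \<comment> \<open>Two points of a ball of radius \<open>s / 2\<close> are within
        \<open>s\<close> of each other, so expansion at \<open>x\<close> applies to \<open>y\<close>
        and separates their images.\<close>
      have "dist y x < s (?m k)"
        using inP(4)[OF xy(1)] inP(4)[OF xy(2)] dist_triangle3[of y x] by (metis (no_types, lifting) dist_commute dist_triangle_half_r)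
      then have "w (?p k) * dist y x \<le> dist (f y) (f x)"
        using inP(2)[OF xy(2)] inP(3)[OF xy(1)] unfolding expands_at_def by blast
      then have "w (?p k) * dist y x \<le> 0" using xy by simp
      then show "x = y" using w[of "?p k"] by (auto simp: mult_le_0_iff)
    qed
  next
    fix k x assume x: "x \<in> C k"
    show "min_stretch (f' x) \<le> \<kappa> * w (?p k)"
    proof (rule ccontr)
      assume "\<not> ?thesis"
      then obtain m' where "expands_at f D (\<kappa> * w (?p k)) (1 / real (Suc m')) x"
        using expands_at_of_derivative[OF der[OF inP(1)[OF x]]] by (meson not_le)
      then show False using inP(5)[OF x] unfolding s_def by blast
    qed
  next
    have cover: "\<exists>i. x \<in> P i" if x: "x \<in> G" for x
    proof -
      let ?l = "min_stretch (f' x)"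
      have "?l > 0"
        using min_stretch_pos[OF has_derivative_linear[OF der[OF x]] det[OF x]] .
      \<comment> \<open>A rational strictly between \<open>?l / \<kappa>\<close> and
        \<open>?l\<close> serves both conditions: below \<open>?l\<close> it gives expansion, and
        its multiple by \<open>\<kappa>\<close> exceeds \<open>?l\<close> and so cannot give
        it.\<close>
      then have "?l / \<kappa> < ?l" using \<open>\<kappa> > 1\<close> by (simp add: divide_less_eq)
      then obtain p where p: "?l / \<kappa> < of_rat p" "of_rat p < ?l"
        using of_rat_dense by blast
      have "(0::real) < of_rat p" using p(1) \<open>?l > 0\<close> \<open>\<kappa> > 1\<close> by (meson divide_pos_pos less_trans zero_less_one)
      then have wp: "w p = of_rat p" by (simp add: w_def)
      obtain m where m: "expands_at f D (w p) (s m) x"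
        using expands_at_of_derivative[OF der[OF x]] p(2) unfolding wp s_def by blast
      have "\<not> expands_at f D (\<kappa> * w p) (s m') x" for m'
      proof
        assume "expands_at f D (\<kappa> * w p) (s m') x"
        then have "\<kappa> * w p \<le> ?l"
          using le_min_stretch_of_expands_at[OF der[OF x] D _ s] x G(2) by blast
        then show False using p(1) \<open>\<kappa> > 1\<close> by (simp add: wp divide_less_eq mult.commute)
      qed
      moreover obtain d where "d \<in> X" "d \<in> ball x (s m / 2)"
        using X(2)[of "ball x (s m / 2)"] s[of m] by auto
      moreover from this obtain j where "z j = d"
        unfolding z_def using from_nat_into_surj[OF X(1)] by blast
      ultimately have "x \<in> P (p, m, j)"
        using x m G(2) by (auto simp: P_def dist_commute)
      then show ?thesis by blast
    qed
    have sub: "K i n \<subseteq> (\<Union>k. C k)" for i n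
      using C_def[of "to_nat (i, n)"] by (force simp: \<iota>_def)
    have "G - (\<Union>k. C k) \<subseteq> (\<Union>i. P i - (\<Union>n. K i n))"
    proof
      fix x assume x: "x \<in> G - (\<Union>k. C k)"
      then obtain i where "x \<in> P i" using cover by blast
      moreover have "x \<notin> (\<Union>n. K i n)" using x sub by blast
      ultimately show "x \<in> (\<Union>i. P i - (\<Union>n. K i n))" by blast
    qed
    moreover have "negligible (\<Union>i. P i - (\<Union>n. K i n))"
      unfolding negligible_iff_null_sets by (rule null_sets_UN) (rule K(3))
    ultimately show "negligible (G - (\<Union>k. C k))" by (rule negligible_subset[rotated])
  qed (use K inP w s in \<open>auto simp: C_def\<close>)
qed

section \<open>Line integrals along image curves\<close>

text \<open>Both measures are restricted to \<open>T\<close> as densities, so that domination is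
  required only on measurable subsets of \<open>T\<close>.\<close>

lemma set_nn_integral_mono_measure:
  assumes sets: "sets M = sets N" and T: "T \<in> sets N" and h: "h \<in> borel_measurable N"
    and le: "\<And>A. A \<in> sets N \<Longrightarrow> emeasure M (A \<inter> T) \<le> K * emeasure N (A \<inter> T)"
  shows "(\<integral>\<^sup>+t\<in>T. h t \<partial>M) \<le> K * (\<integral>\<^sup>+t\<in>T. h t \<partial>N)"
proof -
  have T': "T \<in> sets M" and h': "h \<in> borel_measurable M"
    using T h by (simp_all add: sets cong: measurable_cong_sets)
  have "integral\<^sup>N (density M (indicator T)) h \<le> integral\<^sup>N (density N (\<lambda>t. K * indicator T t)) h"
  proof (rule nn_integral_mono_measure)
    fix A assume "A \<in> sets (density M (indicator T))"
    then have A: "A \<in> sets M" "A \<in> sets N" by (simp_all add: sets)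
    have "emeasure (density M (indicator T)) A = emeasure M (A \<inter> T)"
      using A T' by (subst emeasure_density) (auto simp: nn_integral_indicator Int_commute simp flip: indicator_inter_arith)
    also have "\<dots> \<le> K * emeasure N (A \<inter> T)" by (rule le[OF A(2)])
    also have "\<dots> = emeasure (density N (\<lambda>t. K * indicator T t)) A"
      using A T by (subst emeasure_density)
        (auto simp: mult.assoc nn_integral_cmult nn_integral_indicator Int_commute simp flip: indicator_inter_arith)
    finally show "emeasure (density M (indicator T)) A \<le> emeasure (density N (\<lambda>t. K * indicator T t)) A" .
  qed (simp add: sets)
  then show ?thesis
    using T T' h h' by (simp add: nn_integral_density mult.assoc nn_integral_cmult mult.commute[of "indicator T _"])
qed

lemma curve_in_image:
  assumes "curve_in \<gamma> D" "continuous_on D f"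
  shows "curve_in (fst \<gamma>, f \<circ> snd \<gamma>) (f ` D)"
  using assms(1)
  unfolding curve_in_def is_curve_def by (auto intro!: continuous_on_compose2[OF assms(2)])

text \<open>The parameters in \<open>B\<close>, where the image curve is in \<open>Y\<close>, either
  force the right side to be infinite or are negligible for both lengths. All others fall into the
  disjoint sets \<open>T k\<close>, on which local expansion compares the two length
  measures.\<close>

lemma segment_integral_le_image:
  fixes f :: "'a::euclidean_space \<Rightarrow> 'a"
  assumes f: "continuous_on D f" and \<gamma>: "curve_in \<gamma> D" "loc_rectifiable \<gamma>"
    and \<gamma>': "loc_rectifiable (fst \<gamma>, f \<circ> snd \<gamma>)" and L: "L_N_inv f \<gamma>"
    and ab: "a \<in> fst \<gamma>" "b \<in> fst \<gamma>" "a \<le> b"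
    and S: "\<And>k::nat. S k \<in> sets borel" "disjoint_family S"
    and c: "\<And>k. c k > 0" "\<And>k. r k > 0" "\<And>k x. x \<in> S k \<Longrightarrow> expands_at f D (c k) (r k) x"
    and Y: "Y \<in> sets borel" "f ` (D - (\<Union>k. S k)) \<subseteq> Y"
    and \<rho>: "\<rho> \<in> borel_measurable borel" and \<rho>': "\<rho>' \<in> borel_measurable borel"
    and \<rho>'_Y: "\<And>y. y \<in> Y \<Longrightarrow> \<rho>' y = \<infinity>"
    and \<rho>'_S: "\<And>k x. x \<in> S k \<Longrightarrow> ennreal (1 / c k) * \<rho> x \<le> \<rho>' (f x)"
  shows "(\<integral>\<^sup>+t\<in>{a..b}. \<rho> (snd \<gamma> t) \<partial>interval_measure (seg_fun (snd \<gamma>) a b))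
    \<le> (\<integral>\<^sup>+t\<in>{a..b}. \<rho>' (f (snd \<gamma> t)) \<partial>interval_measure (seg_fun (f \<circ> snd \<gamma>) a b))"
proof -
  define g where "g = snd \<gamma>"
  have cur: "is_curve \<gamma>" and cur': "is_curve (fst \<gamma>, f \<circ> snd \<gamma>)"
    using \<gamma>(1) curve_in_image[OF \<gamma>(1) f] by (auto simp: curve_in_def)
  have rp: "rectifiable_path g a b" and rp': "rectifiable_path (f \<circ> g) a b"
    unfolding g_def
    using rectifiable_path_of_curve[OF cur \<gamma>(2) ab] rectifiable_path_of_curve[OF cur' \<gamma>'] ab by auto
  interpret g: rectifiable_path g a b by (rule rp)
  interpret h: rectifiable_path "f \<circ> g" a b by (rule rp')
  have gD: "g t \<in> D" if "t \<in> {a..b}" for t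
    using subsetD[OF curve_segment(1)[OF cur ab(1,2)] that] \<gamma>(1) by (auto simp: g_def curve_in_def)
  \<comment> \<open>The curve is arbitrary outside [a,b]; \<open>g0\<close> and \<open>h0\<close>
    are globally Borel substitutes that agree with it and its image on the segment.\<close>
  define g0 where "g0 t = (if t \<in> {a..b} then g t else 0)" for t
  define h0 where "h0 t = (if t \<in> {a..b} then f (g t) else 0)" for t
  have g0: "g0 \<in> borel_measurable borel"
    unfolding g0_def by (intro borel_measurable_continuous_on_if g.cont) auto
  have h0: "h0 \<in> borel_measurable borel"
    unfolding h0_def using h.cont by (intro borel_measurable_continuous_on_if) (auto simp: o_def)
  define B where "B = {a..b} \<inter> h0 -` Y"
  define T where "T k = {a..b} \<inter> g0 -` S k" for k
  have B: "B \<in> sets borel" unfolding B_def using measurable_sets[OF h0 Y(1)] by simp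
  have T: "T k \<in> sets borel" for k unfolding T_def using measurable_sets[OF g0 S(1)] by simp
  have T_sub: "T k \<subseteq> {a..b}" for k by (auto simp: T_def)
  have T_iff: "t \<in> T k \<longleftrightarrow> t \<in> {a..b} \<and> g t \<in> S k" for t k by (auto simp: T_def g0_def)
  have B_iff: "t \<in> B \<longleftrightarrow> t \<in> {a..b} \<and> f (g t) \<in> Y" for t by (auto simp: B_def h0_def)
  have disj: "disjoint_family T"
    using S(2) by (auto simp: disjoint_family_on_def T_def)
  have m: "(\<lambda>t. \<rho> (g0 t)) \<in> borel_measurable borel" "(\<lambda>t. \<rho>' (h0 t)) \<in> borel_measurable borel"
    using measurable_compose[OF g0 \<rho>] measurable_compose[OF h0 \<rho>'] by auto
  let ?R = "\<integral>\<^sup>+t\<in>{a..b}. \<rho>' (f (g t)) \<partial>h.M"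
  have R: "?R = (\<integral>\<^sup>+t\<in>{a..b}. \<rho>' (h0 t) \<partial>h.M)"
    by (intro nn_integral_cong) (auto simp: h0_def indicator_def)
  have "(\<integral>\<^sup>+t\<in>{a..b}. \<rho> (g t) \<partial>g.M) \<le> ?R"
  proof (cases "emeasure h.M B = 0")
    case False
    \<comment> \<open>Positive image length inside \<open>Y\<close>, where \<open>\<rho>'\<close> is
      infinite, makes the right side infinite.\<close>
    have "\<infinity> = \<infinity> * emeasure h.M B" using False by (simp add: ennreal_top_mult)
    also have "\<dots> = (\<integral>\<^sup>+t\<in>B. \<infinity> \<partial>h.M)" using B by (simp add: nn_integral_cmult_indicator)
    also have "\<dots> \<le> ?R"
      by (intro nn_integral_mono) (auto simp: B_iff \<rho>'_Y indicator_def)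
    finally have "?R = \<infinity>" by (simp add: top_unique)
    then show ?thesis by simp
  next
    case True
    then have "emeasure g.M B = 0"
      unfolding g_def using B
      by (intro null_length_of_L_N_inv[OF cur \<gamma>(2) cur' \<gamma>' L ab]) (auto simp: B_def)
    then have "B \<in> null_sets g.M" using B by (simp add: null_sets_def)
    then have AE: "AE t in g.M. t \<notin> B" by (rule AE_not_in)
    have "(\<integral>\<^sup>+t\<in>{a..b}. \<rho> (g t) \<partial>g.M) \<le> (\<integral>\<^sup>+t\<in>(\<Union>k. T k). \<rho> (g0 t) \<partial>g.M)"
    proof (rule nn_integral_mono_AE, use AE in eventually_elim)
      fix t assume t: "t \<notin> B"
      show "\<rho> (g t) * indicator {a..b} t \<le> \<rho> (g0 t) * indicator (\<Union>k. T k) t"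
      proof (cases "t \<in> {a..b}")
        case True
        then have "f (g t) \<notin> Y" using t by (simp add: B_iff)
        then have "g t \<in> (\<Union>k. S k)" using Y(2) gD[OF True] by blast
        then have "t \<in> (\<Union>k. T k)" using True by (auto simp: T_iff)
        then show ?thesis using True by (auto simp: g0_def indicator_def)
      qed simp
    qed
    also have "\<dots> = (\<Sum>k. \<integral>\<^sup>+t\<in>T k. \<rho> (g0 t) \<partial>g.M)"
      using m T disj by (intro nn_integral_disjoint_family) auto
    also have "\<dots> \<le> (\<Sum>k. \<integral>\<^sup>+t\<in>T k. \<rho>' (h0 t) \<partial>h.M)"
    proof (intro suminf_le)
      fix k
      have "(\<integral>\<^sup>+t\<in>T k. \<rho> (g0 t) \<partial>g.M) \<le> ennreal (1 / c k) * (\<integral>\<^sup>+t\<in>T k. \<rho> (g0 t) \<partial>h.M)"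
      proof (rule set_nn_integral_mono_measure)
        fix A assume "A \<in> sets h.M"
        then have A: "A \<inter> T k \<in> sets borel" using T by auto
        \<comment> \<open>The expansion estimate restricts only its left side to \<open>T k\<close>;
          applied to \<open>A \<inter> T k\<close> it restricts both.\<close>
        have "emeasure g.M ((A \<inter> T k) \<inter> T k) \<le> ennreal (1 / c k) * emeasure h.M (A \<inter> T k)"
        proof (rule emeasure_length_le_of_locally_expanding[OF rp rp' T T_sub c(1,2) _ A])
          fix s t assume st: "s \<in> T k" "t \<in> {a..b}" "dist (g t) (g s) < r k"
          then show "c k * dist (g t) (g s) \<le> dist ((f \<circ> g) t) ((f \<circ> g) s)"
            using c(3)[of "g s" k] gD[OF st(2)] by (auto simp: T_iff expands_at_def)
        qed
        then show "emeasure g.M (A \<inter> T k) \<le> ennreal (1 / c k) * emeasure h.M (A \<inter> T k)"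
          by (simp add: Int_assoc)
      qed (use T m in auto)
      also have "\<dots> = (\<integral>\<^sup>+t. ennreal (1 / c k) * (\<rho> (g0 t) * indicator (T k) t) \<partial>h.M)"
        using T[of k] m by (intro nn_integral_cmult[symmetric]) simp
      also have "\<dots> \<le> (\<integral>\<^sup>+t\<in>T k. \<rho>' (h0 t) \<partial>h.M)"
        by (intro nn_integral_mono) (auto simp: indicator_def T_iff g0_def h0_def intro: \<rho>'_S)
      finally show "(\<integral>\<^sup>+t\<in>T k. \<rho> (g0 t) \<partial>g.M) \<le> (\<integral>\<^sup>+t\<in>T k. \<rho>' (h0 t) \<partial>h.M)" .
    qed auto
    also have "\<dots> = (\<integral>\<^sup>+t\<in>(\<Union>k. T k). \<rho>' (h0 t) \<partial>h.M)"
      using m T disj by (intro nn_integral_disjoint_family[symmetric]) auto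
    also have "\<dots> \<le> ?R"
      unfolding R by (intro nn_integral_mono) (auto simp: indicator_def T_iff)
    finally show ?thesis .
  qed
  then show ?thesis by (simp add: g_def)
qed

lemma line_integral_le_image:
  fixes f :: "'a::euclidean_space \<Rightarrow> 'a"
  assumes f: "continuous_on D f" and \<gamma>: "curve_in \<gamma> D" "loc_rectifiable \<gamma>"
    and \<gamma>': "loc_rectifiable (fst \<gamma>, f \<circ> snd \<gamma>)" and L: "L_N_inv f \<gamma>"
    and S: "\<And>k::nat. S k \<in> sets borel" "disjoint_family S"
    and c: "\<And>k. c k > 0" "\<And>k. r k > 0" "\<And>k x. x \<in> S k \<Longrightarrow> expands_at f D (c k) (r k) x"
    and Y: "Y \<in> sets borel" "f ` (D - (\<Union>k. S k)) \<subseteq> Y"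
    and \<rho>: "\<rho> \<in> borel_measurable borel" and \<rho>': "\<rho>' \<in> borel_measurable borel"
    and \<rho>'_Y: "\<And>y. y \<in> Y \<Longrightarrow> \<rho>' y = \<infinity>"
    and \<rho>'_S: "\<And>k x. x \<in> S k \<Longrightarrow> ennreal (1 / c k) * \<rho> x \<le> \<rho>' (f x)"
  shows "line_integral \<rho> \<gamma> \<le> line_integral \<rho>' (fst \<gamma>, f \<circ> snd \<gamma>)"
  unfolding line_integral_def
proof (rule SUP_mono)
  fix ab assume "ab \<in> {(a, b). a \<in> fst \<gamma> \<and> b \<in> fst \<gamma> \<and> a \<le> b}"
  then obtain a b where ab: "ab = (a, b)" "a \<in> fst \<gamma>" "b \<in> fst \<gamma>" "a \<le> b" by auto
  have "(\<integral>\<^sup>+t\<in>{a..b}. \<rho> (snd \<gamma> t) \<partial>interval_measure (seg_fun (snd \<gamma>) a b))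
    \<le> (\<integral>\<^sup>+t\<in>{a..b}. \<rho>' (f (snd \<gamma> t)) \<partial>interval_measure (seg_fun (f \<circ> snd \<gamma>) a b))"
    using ab(2-) by (rule segment_integral_le_image[OF f \<gamma> \<gamma>' L _ _ _ S c Y \<rho> \<rho>' \<rho>'_Y \<rho>'_S])
  then show "\<exists>cd\<in>{(a, b). a \<in> fst (fst \<gamma>, f \<circ> snd \<gamma>) \<and> b \<in> fst (fst \<gamma>, f \<circ> snd \<gamma>) \<and> a \<le> b}.
      (\<integral>\<^sup>+t\<in>{fst ab..snd ab}. \<rho> (snd \<gamma> t)
        \<partial>interval_measure (\<lambda>s. enn2real (seg_length (snd \<gamma>) (fst ab) (max (fst ab) (min (snd ab) s)))))
      \<le> (\<integral>\<^sup>+t\<in>{fst cd..snd cd}. \<rho>' (snd (fst \<gamma>, f \<circ> snd \<gamma>) t)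
        \<partial>interval_measure (\<lambda>s. enn2real (seg_length (snd (fst \<gamma>, f \<circ> snd \<gamma>)) (fst cd) (max (fst cd) (min (snd cd) s)))))"
    using ab by (intro bexI[of _ "(a, b)"]) (auto simp: seg_fun_def[abs_def])
qed

lemma line_integral_mono:
  assumes "\<And>x. \<rho> x \<le> \<rho>' x"
  shows "line_integral \<rho> \<gamma> \<le> line_integral \<rho>' \<gamma>"
  unfolding line_integral_def using assms by (intro SUP_mono' nn_integral_mono mult_right_mono) auto

section \<open>Construction of a density on the image side\<close>

lemma nondegenerate_points:
  fixes f :: "real^'n \<Rightarrow> real^'n"
  assumes D: "open D" and diff: "AE x in lebesgue. x \<in> D \<longrightarrow> f differentiable (at x)"
    and Ninv: "N_inv_property f D"
  defines "G \<equiv> {x \<in> D. f differentiable (at x) \<and> det (matrix (frechet_derivative f (at x))) \<noteq> 0}"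
  shows "G \<in> sets lebesgue" and "D - G \<in> null_sets lebesgue"
proof -
  define A where "A = {x \<in> D. \<not> f differentiable (at x)}"
  define Z where "Z = {x \<in> D. f differentiable (at x) \<and> det (matrix (frechet_derivative f (at x))) = 0}"
  obtain N where N: "\<And>x. x \<in> space lebesgue - N \<Longrightarrow> x \<in> D \<longrightarrow> f differentiable (at x)"
      "N \<in> null_sets lebesgue"
    by (rule AE_E3[OF diff]) (assumption | rule that)+
  have "A \<subseteq> N" using N(1) by (auto simp: A_def)
  then have A: "A \<in> null_sets lebesgue"
    using N(2) by (rule null_sets_completion_subset)
  have "negligible (f ` Z)"
    by (rule negligible_image_det_zero[where f' = "\<lambda>x. frechet_derivative f (at x)"])
      (auto simp: Z_def frechet_derivative_works[symmetric] intro: has_derivative_at_withinI)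
  then have "f -` (f ` Z) \<inter> D \<in> null_sets lebesgue"
    using Ninv by (simp add: N_inv_property_def negligible_iff_null_sets)
  then have Z: "Z \<in> null_sets lebesgue"
    by (rule null_sets_completion_subset[rotated]) (auto simp: Z_def)
  \<comment> \<open>Measurability of \<open>G\<close> is read off from the exceptional set: it is an
    open set minus a null set.\<close>
  have eq: "D - G = A \<union> Z" "G = D - (A \<union> Z)" by (auto simp: G_def A_def Z_def)
  show "D - G \<in> null_sets lebesgue" unfolding eq(1) using A Z by (rule null_sets.Un)
  show "G \<in> sets lebesgue" unfolding eq(2) using A Z D by (intro sets.Diff) auto
qed

text \<open>On a compact set a continuous injection has a continuous inverse. Extended by zero it is
  Borel on the whole space, and \<open>f\<close>
  S\<open>becomes a preimage under it within the compact set\<close>f \<open>C\<close>.\<close>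

lemma borel_image_inverse:
  fixes f :: "'a::euclidean_space \<Rightarrow> 'b::euclidean_space"
  assumes C: "compact C" and f: "continuous_on C f" "inj_on f C" and S: "S \<in> sets borel" "S \<subseteq> C"
  obtains g where "g \<in> borel_measurable borel" "\<And>x. x \<in> C \<Longrightarrow> g (f x) = x" "f ` S \<in> sets borel"
proof -
  define g where "g y = (if y \<in> f ` C then the_inv_into C f y else 0)" for y
  have fC: "f ` C \<in> sets borel"
    using C f by (intro borel_closed compact_imp_closed compact_continuous_image)
  have g: "g \<in> borel_measurable borel"
    unfolding g_def
    by (rule borel_measurable_continuous_on_if[OF fC continuous_on_inv_into[OF f(1) C f(2)]]) simp
  have gf: "g (f x) = x" if "x \<in> C" for x
    using that by (simp add: g_def the_inv_into_f_f[OF f(2)])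
  have "f ` S = f ` C \<inter> g -` S"
  proof
    show "f ` C \<inter> g -` S \<subseteq> f ` S"
      using gf by (auto intro!: imageI)
  qed (use S gf in auto)
  then have "f ` S \<in> sets borel"
    using measurable_sets[OF g S(1)] fC by simp
  with g gf show thesis by (rule that)
qed

lemma ex_image_density:
  fixes f :: "real^'n \<Rightarrow> real^'n"
  assumes D: "open D" and f: "continuous_on D f" and q: "q \<ge> 1" and \<kappa>: "\<kappa> > 1"
    and diff: "AE x in lebesgue. x \<in> D \<longrightarrow> f differentiable (at x)"
    and N: "N_property f D" and Ninv: "N_inv_property f D"
    and \<rho>: "\<rho> \<in> borel_measurable borel"
  obtains \<rho>' where "\<rho>' \<in> borel_measurable borel"
    "(\<integral>\<^sup>+y. epow (\<rho>' y) q \<partial>lebesgue)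
       \<le> ennreal (\<kappa> powr q) * (\<integral>\<^sup>+x\<in>D. K_I q x f * epow (\<rho> x) q \<partial>lebesgue)"
    "\<And>\<gamma>. curve_in \<gamma> D \<Longrightarrow> loc_rectifiable \<gamma> \<Longrightarrow> loc_rectifiable (fst \<gamma>, f \<circ> snd \<gamma>) \<Longrightarrow> L_N_inv f \<gamma>
       \<Longrightarrow> line_integral \<rho> \<gamma> \<le> line_integral \<rho>' (fst \<gamma>, f \<circ> snd \<gamma>)"
proof -
  let ?f' = "\<lambda>x. frechet_derivative f (at x)"
  define J where "J x = \<bar>det (matrix (?f' x))\<bar>" for x
  define G where "G = {x \<in> D. f differentiable (at x) \<and> det (matrix (?f' x)) \<noteq> 0}"
  have G: "G \<in> sets lebesgue" "D - G \<in> null_sets lebesgue" "G \<subseteq> D"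
    using nondegenerate_points[OF D diff Ninv] by (auto simp: G_def)
  have der: "(f has_derivative ?f' x) (at x)" if "x \<in> G" for x
    using that by (simp add: G_def frechet_derivative_works[symmetric])
  have det: "det (matrix (?f' x)) \<noteq> 0" if "x \<in> G" for x
    using that by (simp add: G_def)
  obtain C c r where C: "\<And>k::nat. compact (C k)" "\<And>k. C k \<subseteq> G" and c: "\<And>k. c k > 0" "\<And>k. r k > 0"
    and exp: "\<And>k x. x \<in> C k \<Longrightarrow> expands_at f D (c k) (r k) x" and inj: "\<And>k. inj_on f (C k)"
    and l: "\<And>k x. x \<in> C k \<Longrightarrow> min_stretch (?f' x) \<le> \<kappa> * c k"
    and neg: "negligible (G - (\<Union>k. C k))"
    by (rule ex_expanding_compact_pieces[OF D f G(1,3) der det \<kappa>]) (assumption | rule that)+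
  \<comment> \<open>Disjointness lets each point contribute to one summand only; compactness is kept
    in the surrounding \<open>C k\<close>, where the inverse is taken.\<close>
  define S where "S = disjointed C"
  have S: "\<And>k. S k \<in> sets borel" "disjoint_family S" "\<And>k. S k \<subseteq> C k" "(\<Union>k. S k) = (\<Union>k. C k)"
  proof -
    show "S k \<in> sets borel" for k
      unfolding S_def disjointed_def using C(1) by (intro sets.Diff sets.finite_UN) (auto simp: compact_imp_closed)
  qed (auto simp: S_def disjoint_family_disjointed UN_disjointed_eq disjointed_subset subsetD[OF disjointed_subset])
  have SG: "x \<in> G" "x \<in> D" if "x \<in> S k" for x k using that S(3) C(2) G(3) by blast+
  have "\<exists>g. g \<in> borel_measurable borel \<and> (\<forall>x\<in>C k. g (f x) = x) \<and> f ` S k \<in> sets borel" for k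
  proof -
    have "continuous_on (C k) f" using continuous_on_subset[OF f] C(2) G(3) by blast
    then show ?thesis using borel_image_inverse[OF C(1) _ inj S(1) S(3)] by metis
  qed
  then obtain g where g: "\<And>k. g k \<in> borel_measurable borel" "\<And>k x. x \<in> C k \<Longrightarrow> g k (f x) = x"
    and fS: "\<And>k. f ` S k \<in> sets borel" by metis
  have gS: "g k (f x) = x" if "x \<in> S k" for k x using that S(3) g(2) by blast
  have "D - (\<Union>k. S k) \<subseteq> (D - G) \<union> (G - (\<Union>k. C k))" using S(4) by auto
  then have "D - (\<Union>k. S k) \<in> null_sets lebesgue"
    using G(2) neg unfolding negligible_iff_null_sets by (meson null_sets.Un null_sets_completion_subset)
  then have "f ` (D - (\<Union>k. S k)) \<in> null_sets lebesgue"
    using N unfolding N_property_def by blast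
  \<comment> \<open>The image of the exceptional set is merely Lebesgue null; a Borel null superset
    makes \<open>\<rho>'\<close> Borel.\<close>
  then obtain Y where Y: "Y \<in> null_sets lborel" "f ` (D - (\<Union>k. S k)) \<subseteq> Y"
    unfolding null_sets_completion_iff2 by blast
  then have Yb: "Y \<in> sets borel" by auto
  define \<psi> where "\<psi> k y = (ennreal (1 / c k) * \<rho> (g k y)) * indicator (f ` S k) y" for k y
  have \<psi>: "\<psi> k \<in> borel_measurable borel" for k
    unfolding \<psi>_def[abs_def] using fS measurable_compose[OF g(1) \<rho>] by simp
  define \<rho>' where "\<rho>' y = (if y \<in> Y then \<infinity> else SUP k. \<psi> k y)" for y
  have \<rho>': "\<rho>' \<in> borel_measurable borel"
    unfolding \<rho>'_def[abs_def] using Yb \<psi> by (intro measurable_If_set borel_measurable_SUP) auto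
  have q0: "q > 0" using q by simp
  have JS: "(\<lambda>x. ennreal (J x) * indicator (S k) x) \<in> borel_measurable lebesgue" for k
  proof -
    have SL: "S k \<in> sets lebesgue" using S(1) by simp
    have "(\<lambda>x. det (matrix (?f' x))) \<in> borel_measurable (lebesgue_on (S k))"
      using SL by (rule measurable_det_derivative) (use der SG in \<open>blast intro: has_derivative_at_withinI\<close>)
    then have "(\<lambda>x. ennreal (J x)) \<in> borel_measurable (lebesgue_on (S k))"
      unfolding J_def by measurable
    then show ?thesis
      using SL by (subst borel_measurable_restrict_space_iff_ennreal[symmetric]) auto
  qed
  have \<rho>L: "(\<lambda>x. epow (\<rho> x) q) \<in> borel_measurable lebesgue"
    using \<rho> by (intro measurable_completion) measurable
  \<comment> \<open>This is the integrand of the right side with l(f'(x)) replaced by its upper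
    bound \<open>\<kappa> * c k\<close>. It is therefore a measurable minorant of that integrand,
    and \<open>\<kappa> powr q\<close> is the factor left over from \<open>1 / c k\<close>.\<close>
  define W where "W k x = (ennreal ((1 / (\<kappa> * c k)) powr q) * ennreal (J x) * epow (\<rho> x) q) * indicator (S k) x" for k x
  have W: "W k \<in> borel_measurable lebesgue" for k
  proof -
    have "(\<lambda>x. ennreal ((1 / (\<kappa> * c k)) powr q) * (ennreal (J x) * indicator (S k) x) * epow (\<rho> x) q)
      \<in> borel_measurable lebesgue"
      by (rule borel_measurable_times_ennreal[OF borel_measurable_times_ennreal[OF _ JS] \<rho>L]) simp
    then show ?thesis unfolding W_def[abs_def] by (simp add: ac_simps)
  qed
  have \<psi>_int: "(\<integral>\<^sup>+y. epow (\<psi> k y) q \<partial>lborel) \<le> ennreal (\<kappa> powr q) * (\<integral>\<^sup>+x. W k x \<partial>lebesgue)" for k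
  proof -
    let ?h = "\<lambda>y. ennreal ((1 / c k) powr q) * epow (\<rho> (g k y)) q"
    have h: "?h \<in> borel_measurable borel"
      using measurable_compose[OF g(1) \<rho>] by measurable
    have "(\<integral>\<^sup>+y. epow (\<psi> k y) q \<partial>lborel) = (\<integral>\<^sup>+y\<in>f ` S k. ?h y \<partial>lborel)"
      using c by (intro nn_integral_cong) (auto simp: \<psi>_def indicator_def epow_cmult)
    also have "\<dots> \<le> (\<integral>\<^sup>+x\<in>S k. ennreal \<bar>det (matrix (?f' x))\<bar> * ?h (f x) \<partial>lebesgue)"
      by (rule nn_integral_differentiable_image_le[OF S(1) _ fS h])
        (use der SG in \<open>blast intro: has_derivative_at_withinI\<close>)
    also have "\<dots> = (\<integral>\<^sup>+x. ennreal (\<kappa> powr q) * W k x \<partial>lebesgue)"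
    proof (intro nn_integral_cong)
      fix x
      have "(1 / c k) powr q = \<kappa> powr q * (1 / (\<kappa> * c k)) powr q"
        using \<kappa> c[of k] by (simp flip: powr_mult)
      then have "ennreal ((1 / c k) powr q) = ennreal (\<kappa> powr q) * ennreal ((1 / (\<kappa> * c k)) powr q)"
        by (simp only: ennreal_mult powr_ge_zero)
      then show "ennreal \<bar>det (matrix (?f' x))\<bar> * ?h (f x) * indicator (S k) x = ennreal (\<kappa> powr q) * W k x"
        by (auto simp: W_def J_def indicator_def gS ac_simps)
    qed
    also have "\<dots> = ennreal (\<kappa> powr q) * (\<integral>\<^sup>+x. W k x \<partial>lebesgue)"
      using W by (intro nn_integral_cmult)
    finally show ?thesis .
  qed
  \<comment> \<open>At most one summand is nonzero at \<open>x\<close>, and there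
    \<open>\<kappa> * c j\<close> is at least the minimal stretching, so dividing by its power gives
    at most K_I.\<close>
  have W_le: "(\<Sum>k. W k x) \<le> K_I q x f * epow (\<rho> x) q * indicator D x" for x
  proof (cases "\<exists>j. x \<in> S j")
    case True
    then obtain j where j: "x \<in> S j" by auto
    have "(\<Sum>k. W k x) = ennreal ((1 / (\<kappa> * c j)) powr q) * ennreal (J x) * epow (\<rho> x) q"
      unfolding W_def by (rule suminf_cmult_indicator[OF S(2) j])
    moreover have "ennreal ((1 / (\<kappa> * c j)) powr q) * ennreal (J x) \<le> K_I q x f"
    proof -
      have pos: "0 < min_stretch (?f' x)"
        using min_stretch_pos[OF has_derivative_linear[OF der] det] SG(1)[OF j] by blast
      have "min_stretch (?f' x) powr q \<le> (\<kappa> * c j) powr q"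
        using l[of x j] S(3) j pos q0 by (intro powr_mono2) auto
      moreover have "min_stretch (?f' x) powr q > 0" using pos by simp
      ultimately have "J x / (\<kappa> * c j) powr q \<le> J x / min_stretch (?f' x) powr q"
        by (intro divide_left_mono mult_pos_pos) (auto simp: J_def)
      moreover have "(1 / (\<kappa> * c j)) powr q * J x = J x / (\<kappa> * c j) powr q"
        using \<kappa> c[of j] by (simp add: powr_divide)
      moreover have "K_I q x f = ennreal (J x / min_stretch (?f' x) powr q)"
        using SG(1)[OF j] by (simp add: K_I_def J_def G_def Let_def)
      ultimately show ?thesis
        by (simp add: ennreal_mult[symmetric] J_def ennreal_leI)
    qed
    ultimately show ?thesis using SG(2)[OF j] by (simp add: mult_right_mono)
  next
    case False
    then show ?thesis by (simp add: W_def)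
  qed
  show thesis
  proof (rule that[OF \<rho>'])
    have "(\<integral>\<^sup>+y. epow (\<rho>' y) q \<partial>lebesgue) = (\<integral>\<^sup>+y. epow (\<rho>' y) q \<partial>lborel)"
      by (rule nn_integral_completion)
    also have "\<dots> \<le> (\<integral>\<^sup>+y. (\<Sum>k. epow (\<psi> k y) q) \<partial>lborel)"
    proof (rule nn_integral_mono_AE, use AE_not_in[OF Y(1)] in eventually_elim)
      fix y assume "y \<notin> Y"
      \<comment> \<open>Overlapping images are paid for here: each term is bounded by the whole
        series, hence so is the power of the supremum.\<close>
      have le: "epow (\<psi> k y) q \<le> (\<Sum>k. epow (\<psi> k y) q)" for k
        using sum_le_suminf[of "\<lambda>k. epow (\<psi> k y) q" "{k}"] by simp
      show "epow (\<rho>' y) q \<le> (\<Sum>k. epow (\<psi> k y) q)"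
        unfolding \<rho>'_def using \<open>y \<notin> Y\<close> epow_SUP_le[where I = UNIV, OF q0 le] by simp
    qed
    also have "\<dots> = (\<Sum>k. \<integral>\<^sup>+y. epow (\<psi> k y) q \<partial>lborel)"
    proof (rule nn_integral_suminf)
      show "(\<lambda>y. epow (\<psi> k y) q) \<in> borel_measurable lborel" for k
        using measurable_compose[OF \<psi> measurable_epow] by simp
    qed
    also have "\<dots> \<le> (\<Sum>k. ennreal (\<kappa> powr q) * (\<integral>\<^sup>+x. W k x \<partial>lebesgue))"
      by (intro suminf_le \<psi>_int) auto
    also have "\<dots> = ennreal (\<kappa> powr q) * (\<integral>\<^sup>+x. (\<Sum>k. W k x) \<partial>lebesgue)"
      using W by (simp add: nn_integral_suminf)
    also have "\<dots> \<le> ennreal (\<kappa> powr q) * (\<integral>\<^sup>+x\<in>D. K_I q x f * epow (\<rho> x) q \<partial>lebesgue)"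
      using W_le by (intro mult_left_mono nn_integral_mono) auto
    finally show "(\<integral>\<^sup>+y. epow (\<rho>' y) q \<partial>lebesgue)
       \<le> ennreal (\<kappa> powr q) * (\<integral>\<^sup>+x\<in>D. K_I q x f * epow (\<rho> x) q \<partial>lebesgue)" .
  next
    fix \<gamma> :: "(real^'n) curve"
    assume \<gamma>: "curve_in \<gamma> D" "loc_rectifiable \<gamma>" "loc_rectifiable (fst \<gamma>, f \<circ> snd \<gamma>)" "L_N_inv f \<gamma>"
    show "line_integral \<rho> \<gamma> \<le> line_integral \<rho>' (fst \<gamma>, f \<circ> snd \<gamma>)"
    proof (rule line_integral_le_image[OF f \<gamma> S(1,2) c _ Yb Y(2) \<rho> \<rho>'])
      fix k x assume x: "x \<in> S k"
      then show "expands_at f D (c k) (r k) x" using exp S(3) by blast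
      have "ennreal (1 / c k) * \<rho> x = \<psi> k (f x)" using x by (simp add: \<psi>_def gS)
      also have "\<dots> \<le> \<rho>' (f x)" by (auto simp: \<rho>'_def intro: SUP_upper)
      finally show "ennreal (1 / c k) * \<rho> x \<le> \<rho>' (f x)" .
    qed (simp add: \<rho>'_def)
  qed
qed

theorem theorem2p2:
  fixes f :: "real^'n \<Rightarrow> real^'n" and D :: "(real^'n) set" and q :: real
    and \<Gamma> :: "(real^'n) curve set" and \<rho> :: "real^'n \<Rightarrow> ennreal"
  assumes "CARD('n) \<ge> 2"
    and "open D" and "connected D" and "D \<noteq> {}"
    and "q \<ge> 1"
    and "continuous_on D f"
    and "AE x in lebesgue. x \<in> D \<longrightarrow> f differentiable (at x)"
    and "N_property f D" and "N_inv_property f D"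
    and "L2_property q f D"
    and "\<forall>\<gamma>\<in>\<Gamma>. curve_in \<gamma> D"
    and "\<rho> \<in> adm \<Gamma>"
  shows "modulus q (curve_image f \<Gamma>) \<le> (\<integral>\<^sup>+ x \<in> D. K_I q x f * epow (\<rho> x) q \<partial>lebesgue)"
proof -
  let ?I = "\<integral>\<^sup>+ x \<in> D. K_I q x f * epow (\<rho> x) q \<partial>lebesgue"
  let ?m = "modulus q (curve_image f \<Gamma>)"
  have q0: "q > 0" using \<open>q \<ge> 1\<close> by simp
  obtain \<Gamma>0 where \<Gamma>0: "modulus q \<Gamma>0 = 0"
    and L2: "\<And>\<gamma>' \<gamma>. curve_in \<gamma>' (f ` D) \<Longrightarrow> \<gamma>' \<notin> \<Gamma>0 \<Longrightarrow> curve_in \<gamma> D \<Longrightarrow> fst \<gamma> = fst \<gamma>' \<Longrightarrow>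
      (\<forall>t\<in>fst \<gamma>. f (snd \<gamma> t) = snd \<gamma>' t) \<Longrightarrow> loc_rectifiable \<gamma> \<and> (loc_rectifiable \<gamma>' \<longrightarrow> L_N_inv f \<gamma>)"
    using \<open>L2_property q f D\<close> unfolding L2_property_def by blast
  have \<rho>: "\<rho> \<in> borel_measurable borel" and adm: "\<And>\<gamma>. \<gamma> \<in> \<Gamma> \<Longrightarrow> loc_rectifiable \<gamma> \<Longrightarrow> 1 \<le> line_integral \<rho> \<gamma>"
    using \<open>\<rho> \<in> adm \<Gamma>\<close> by (auto simp: adm_def)
  have "?m \<le> ennreal (\<kappa> powr q) * ?I + ennreal e" if "\<kappa> > 1" "e > 0" for \<kappa> e
  proof -
    obtain \<rho>' where \<rho>': "\<rho>' \<in> borel_measurable borel"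
      "(\<integral>\<^sup>+y. epow (\<rho>' y) q \<partial>lebesgue) \<le> ennreal (\<kappa> powr q) * ?I"
      "\<And>\<gamma>. curve_in \<gamma> D \<Longrightarrow> loc_rectifiable \<gamma> \<Longrightarrow> loc_rectifiable (fst \<gamma>, f \<circ> snd \<gamma>) \<Longrightarrow> L_N_inv f \<gamma>
       \<Longrightarrow> line_integral \<rho> \<gamma> \<le> line_integral \<rho>' (fst \<gamma>, f \<circ> snd \<gamma>)"
      by (rule ex_image_density[OF \<open>open D\<close> \<open>continuous_on D f\<close> \<open>q \<ge> 1\<close> \<open>\<kappa> > 1\<close> assms(7-9) \<rho>])
        (assumption | rule that)+
    have "modulus q \<Gamma>0 < ennreal e" using \<Gamma>0 \<open>e > 0\<close> by simp
    then obtain \<rho>0 where \<rho>0: "\<rho>0 \<in> adm \<Gamma>0" "(\<integral>\<^sup>+y. epow (\<rho>0 y) q \<partial>lebesgue) < ennreal e"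
      unfolding modulus_def INF_less_iff by blast
    have \<rho>0b: "\<rho>0 \<in> borel_measurable borel" using \<rho>0(1) by (simp add: adm_def)
    \<comment> \<open>Image curves in \<open>\<Gamma>0\<close> are handled by
      \<open>\<rho>0\<close>, all others by \<open>\<rho>'\<close>; the maximum is admissible for
      both kinds, and its power is at most the sum of the two powers.\<close>
    let ?\<rho> = "\<lambda>y. max (\<rho>' y) (\<rho>0 y)"
    have "?\<rho> \<in> adm (curve_image f \<Gamma>)"
      unfolding adm_def
    proof (intro CollectI conjI ballI impI)
      show "?\<rho> \<in> borel_measurable borel" using \<rho>'(1) \<rho>0b by simp
      fix \<gamma>' assume "\<gamma>' \<in> curve_image f \<Gamma>" and rect': "loc_rectifiable \<gamma>'"
      then obtain \<gamma> where \<gamma>: "\<gamma> \<in> \<Gamma>" "\<gamma>' = (fst \<gamma>, f \<circ> snd \<gamma>)" unfolding curve_image_def by auto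
      have cur: "curve_in \<gamma> D" using \<gamma>(1) assms(11) by blast
      show "1 \<le> line_integral ?\<rho> \<gamma>'"
      proof (cases "\<gamma>' \<in> \<Gamma>0")
        case True
        then have "1 \<le> line_integral \<rho>0 \<gamma>'" using \<rho>0(1) rect' by (simp add: adm_def)
        also have "\<dots> \<le> line_integral ?\<rho> \<gamma>'" by (rule line_integral_mono) simp
        finally show ?thesis .
      next
        case False
        have "loc_rectifiable \<gamma> \<and> (loc_rectifiable \<gamma>' \<longrightarrow> L_N_inv f \<gamma>)"
          using curve_in_image[OF cur \<open>continuous_on D f\<close>] False cur \<gamma>(2) by (intro L2[of \<gamma>']) auto
        then have rect: "loc_rectifiable \<gamma>" and L: "L_N_inv f \<gamma>" using rect' by auto
        have "1 \<le> line_integral \<rho> \<gamma>" using adm[OF \<gamma>(1) rect] .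
        also have "\<dots> \<le> line_integral \<rho>' \<gamma>'" using \<rho>'(3)[OF cur rect _ L] rect' \<gamma>(2) by simp
        also have "\<dots> \<le> line_integral ?\<rho> \<gamma>'" by (rule line_integral_mono) simp
        finally show ?thesis .
      qed
    qed
    then have "?m \<le> (\<integral>\<^sup>+y. epow (?\<rho> y) q \<partial>lebesgue)"
      unfolding modulus_def by (rule INF_lower)
    also have "\<dots> \<le> (\<integral>\<^sup>+y. epow (\<rho>' y) q + epow (\<rho>0 y) q \<partial>lebesgue)"
      by (intro nn_integral_mono epow_max_le q0)
    also have "\<dots> = (\<integral>\<^sup>+y. epow (\<rho>' y) q \<partial>lebesgue) + (\<integral>\<^sup>+y. epow (\<rho>0 y) q \<partial>lebesgue)"
    proof (rule nn_integral_add)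
      show "(\<lambda>y. epow (\<rho>' y) q) \<in> borel_measurable lebesgue" "(\<lambda>y. epow (\<rho>0 y) q) \<in> borel_measurable lebesgue"
        using measurable_compose[OF \<rho>'(1) measurable_epow] measurable_compose[OF \<rho>0b measurable_epow]
        by (simp_all add: measurable_completion)
    qed
    also have "\<dots> \<le> ennreal (\<kappa> powr q) * ?I + ennreal e"
      using \<rho>'(2) \<rho>0(2) by (intro add_mono) auto
    finally show ?thesis .
  qed
  then have le: "?m \<le> ennreal (\<kappa> powr q) * ?I" if "\<kappa> > 1" for \<kappa>
    using that ennreal_le_epsilon[of "ennreal (\<kappa> powr q) * ?I" ?m] by blast
  show ?thesis
  \<comment> \<open>An infinite right side is trivial. For a finite value \<open>v\<close> the bound
    \<open>\<kappa> powr q * v\<close> is real and continuous in \<open>\<kappa>\<close>, so it can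
    be taken to the limit from the right at 1.\<close>
  proof (cases ?I)
    case (real v)
    have "((\<lambda>\<kappa>. ennreal (\<kappa> powr q * v)) \<longlongrightarrow> ennreal (1 powr q * v)) (at_right 1)"
      by (intro tendsto_ennrealI tendsto_intros) auto
    moreover have "\<forall>\<^sub>F \<kappa> in at_right 1. ?m \<le> ennreal (\<kappa> powr q * v)"
      using eventually_at_right_less[of 1] by eventually_elim (use le real in \<open>simp add: ennreal_mult\<close>)
    ultimately have "?m \<le> ennreal (1 powr q * v)"
      by (intro tendsto_lowerbound) auto
    then show ?thesis using real by simp
  qed simp
qed

end
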